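(* Let $G=(V,E)$ be a graph with at least $d+1$ vertices where $d\geq 2$. If $|E|\leq d|V|$ then (i) $a(G,\ell_\infty^d)\leq 1$, and (ii) $a(G,\ell_\infty^d)=1$ if and only if $d=2$ and $G$ is (isomorphic to) the octahedral graph $K_{2,2,2}$.
   Context: All graphs are finite and simple. $\ell_\infty^d=(\mathbb{R}^d,\|\cdot\|_\infty)$, $\|x\|_\infty=\max_i|x_i|$; $b_1,\ldots,b_d$ is the standard basis. A framework in $\ell_\infty^d$ is $(G,p)$, $p\in(\mathbb{R}^d)^V$, such that for every edge $vw$, $p_v\neq p_w$ and there is a unique index $i$ with $|(p_v-p_w)_i|=\|p_v-p_w\|_\infty$; $\mathcal{W}(G,\ell_\infty^d)$ denotes the set of such $p$, and for such an edge $\varphi_{v,w}=\operatorname{sgn}((p_v-p_w)_i)\,b_i^\top$. The rigidity matrix $R(G,p)$ is the $|E|\times d|V|$ matrix whose row for edge $vw$ has $\varphi_{v,w}$ in the columns of $v$, $-\varphi_{v,w}$ in the columns of $w$, zeros elsewhere; $L(G,p)=R(G,p)^\top R(G,p)$ with eigenvalues $\lambda_1\le\lambda_2\le\cdots$ counted with multiplicity. For $G$ with at least $d+1$ vertices, $a(G,\ell_\infty^d)=\sup\{\lambda_{d+1}(L(G,p)):p\in\mathcal{W}(G,\ell_\infty^d)\}$. $K_{2,2,2}$ is the complete tripartite graph with three parts of size two. *)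

theory Defs
  imports
    Complex_Main
    "HOL-Library.Ramsey"
    "Jordan_Normal_Form.Char_Poly"
begin

definition simple_graph :: "'v set \<Rightarrow> 'v set set \<Rightarrow> bool" where
  "simple_graph V E \<longleftrightarrow> finite V \<and> E \<subseteq> [V]\<^bsup>2\<^esup>"

definition graph_iso :: "'v set \<Rightarrow> 'v set set \<Rightarrow> 'w set \<Rightarrow> 'w set set \<Rightarrow> bool" where
  "graph_iso V E V' E' \<longleftrightarrow>
     (\<exists>f. bij_betw f V V' \<and> (\<forall>v\<in>V. \<forall>w\<in>V. {v, w} \<in> E \<longleftrightarrow> {f v, f w} \<in> E'))"

text \<open>The complete tripartite graph with three parts of size two; the vertex \<open>(i, j)\<close> is
  the \<open>j\<close>-th element of the \<open>i\<close>-th part.\<close>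

definition K222_verts :: "(nat \<times> nat) set" where
  "K222_verts = {0..<3} \<times> {0..<2}"

definition K222_edges :: "(nat \<times> nat) set set" where
  "K222_edges = {{u, w} | u w. u \<in> K222_verts \<and> w \<in> K222_verts \<and> fst u \<noteq> fst w}"

text \<open>The norm is only meaningful for vectors of positive dimension.\<close>

definition linf_norm :: "real vec \<Rightarrow> real" where
  "linf_norm x = Max ((\<lambda>i. \<bar>x $ i\<bar>) ` {0..<dim_vec x})"

text \<open>The set of placements \<open>p\<close> for which \<open>(G, p)\<close> is a framework.
  The values of \<open>p\<close> outside of \<open>V\<close> are irrelevant.\<close>

definition placements :: "nat \<Rightarrow> 'v set \<Rightarrow> 'v set set \<Rightarrow> ('v \<Rightarrow> real vec) set" where
  "placements d V E = {p. (\<forall>v\<in>V. p v \<in> carrier_vec d) \<and>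
     (\<forall>v w. {v, w} \<in> E \<longrightarrow>
        p v \<noteq> p w \<and> (\<exists>!i. i < d \<and> \<bar>(p v - p w) $ i\<bar> = linf_norm (p v - p w)))}"

definition support_functional :: "nat \<Rightarrow> ('v \<Rightarrow> real vec) \<Rightarrow> 'v \<Rightarrow> 'v \<Rightarrow> real vec" where
  "support_functional d p v w =
     (let i = (THE i. i < d \<and> \<bar>(p v - p w) $ i\<bar> = linf_norm (p v - p w))
      in sgn ((p v - p w) $ i) \<cdot>\<^sub>v unit_vec d i)"

text \<open>Matrices are indexed by natural numbers, so we fix orderings of \<open>V\<close> and \<open>E\<close>; a different
  choice permutes rows and columns of the rigidity matrix and does not change the eigenvalues of
  \<open>L(G, p)\<close>.\<close>

definition enum_list :: "'a set \<Rightarrow> 'a list" where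
  "enum_list A = (SOME xs. set xs = A \<and> distinct xs)"

text \<open>Column \<open>d * k + i\<close> belongs to the \<open>i\<close>-th coordinate of the \<open>k\<close>-th vertex. Since
  \<open>\<phi>\<^bsub>w,v\<^esub> = - \<phi>\<^bsub>v,w\<^esub>\<close>, the row of the edge \<open>vw\<close> has the entry \<open>\<phi>\<^bsub>v,w\<^esub>\<close> at \<open>v\<close> and \<open>\<phi>\<^bsub>w,v\<^esub>\<close> at \<open>w\<close>:
  at an end \<open>u\<close> of \<open>e\<close> it is \<open>\<phi>\<^bsub>u,x\<^esub>\<close> where \<open>x\<close> is the other end.\<close>

definition rigidity_matrix :: "nat \<Rightarrow> 'v set \<Rightarrow> 'v set set \<Rightarrow> ('v \<Rightarrow> real vec) \<Rightarrow> real mat" where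
  "rigidity_matrix d V E p = mat (card E) (d * card V) (\<lambda>(r, c).
     let e = enum_list E ! r; u = enum_list V ! (c div d)
     in if u \<in> e then support_functional d p u (THE x. e = {u, x}) $ (c mod d) else 0)"

definition stiffness_matrix :: "nat \<Rightarrow> 'v set \<Rightarrow> 'v set set \<Rightarrow> ('v \<Rightarrow> real vec) \<Rightarrow> real mat" where
  "stiffness_matrix d V E p = transpose_mat (rigidity_matrix d V E p) * rigidity_matrix d V E p"

text \<open>The \<open>k\<close>-th smallest real eigenvalue, counted with multiplicity, where \<open>k\<close> starts at \<open>1\<close>.\<close>

definition nth_eigenvalue :: "nat \<Rightarrow> real mat \<Rightarrow> real" where
  "nth_eigenvalue k A = sorted_list_of_multiset (proots (char_poly A)) ! (k - 1)"

definition alg_connectivity :: "nat \<Rightarrow> 'v set \<Rightarrow> 'v set set \<Rightarrow> real" where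
  "alg_connectivity d V E =
     (SUP p \<in> placements d V E. nth_eigenvalue (d + 1) (stiffness_matrix d V E p))"

end

theory Submission
  imports Defs "Jordan_Normal_Form.Jordan_Normal_Form_Uniqueness"
    "Jordan_Normal_Form.Jordan_Normal_Form_Existence"
begin

text \<open>
  Colour every edge by the coordinate in which its ends are furthest apart. The stiffness matrix is
  then the direct sum of the Laplacians of the \<open>d\<close> monochromatic subgraphs, so
  \<open>\<lambda>\<^bsub>d+1\<^esub>\<close> is the least of their algebraic connectivities.

  Suppose that all of them are at least \<open>1\<close>. A vertex of degree at most one in some colour would
  force its neighbour to be joined to all other vertices in that colour, hence to be isolated in the
  other colours, which is impossible. So all monochromatic degrees are at least two, and
  \<open>|E| \<le> d|V|\<close> makes every monochromatic subgraph 2-regular. A test vector now gives \<open>|V| \<le> 6\<close> and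
  \<open>\<lambda>\<^bsub>d+1\<^esub> \<le> 1\<close> if \<open>|V| = 6\<close>, whereas counting neighbours gives \<open>|V| \<ge> 2d + 1\<close>; hence \<open>d = 2\<close>.
  Five vertices are impossible, because the monochromatic subgraphs of \<open>K\<^sub>5\<close> are comparability
  graphs but the pentagon is not. On six vertices the graph is 4-regular, so it is the octahedron.

  Conversely, the octahedron has a placement for which both monochromatic subgraphs are hexagons.
  The supremum is attained since there are only finitely many rigidity matrices.
\<close>

section \<open>Diagonalization of symmetric matrices\<close>

text \<open>For an eigenvector \<open>v\<close> the sum \<open>S\<close> (conjugate of
  \<open>v\<close>, times \<open>A\<close>, times \<open>v\<close>) is its own conjugate by
  symmetry, and it equals \<open>a\<close> times the positive squared norm of
  \<open>v\<close>.\<close>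

lemma symmetric_complex_eigenvalue_real:
  fixes A :: "real mat"
  assumes A: "A \<in> carrier_mat n n" and sym: "transpose_mat A = A"
    and ev: "eigenvalue (map_mat complex_of_real A) a"
  shows "a \<in> \<real>"
proof -
  let ?A = "map_mat complex_of_real A"
  obtain v where v: "v \<in> carrier_vec n" "v \<noteq> 0\<^sub>v n" and Av: "?A *\<^sub>v v = a \<cdot>\<^sub>v v"
    using ev A unfolding eigenvalue_def eigenvector_def by auto
  have symA: "A $$ (i, j) = A $$ (j, i)" if "i < n" "j < n" for i j
    using that A index_transpose_mat(1)[of i A j] by (simp add: sym)
  have row: "(\<Sum>j<n. complex_of_real (A $$ (i, j)) * v $ j) = a * v $ i" if "i < n" for i
  proof -
    have "(?A *\<^sub>v v) $ i = (a \<cdot>\<^sub>v v) $ i" using Av by simp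
    then show ?thesis using that A v
      by (simp add: scalar_prod_def lessThan_atLeast0)
  qed
  define S where "S = (\<Sum>i<n. \<Sum>j<n. cnj (v $ i) * complex_of_real (A $$ (i, j)) * v $ j)"
  define r where "r = (\<Sum>i<n. (cmod (v $ i))\<^sup>2)"
  have "S = (\<Sum>i<n. cnj (v $ i) * (\<Sum>j<n. complex_of_real (A $$ (i, j)) * v $ j))"
    unfolding S_def by (simp add: sum_distrib_left mult.assoc)
  also have "\<dots> = (\<Sum>i<n. a * (v $ i * cnj (v $ i)))"
    by (rule sum.cong) (simp_all add: row)
  also have "\<dots> = a * complex_of_real r"
    unfolding r_def of_real_sum by (simp only: sum_distrib_left complex_norm_square)
  finally have S: "S = a * complex_of_real r" .
  have "cnj S = (\<Sum>i<n. \<Sum>j<n. v $ i * complex_of_real (A $$ (i, j)) * cnj (v $ j))"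
    unfolding S_def by simp
  also have "\<dots> = (\<Sum>j<n. \<Sum>i<n. v $ i * complex_of_real (A $$ (i, j)) * cnj (v $ j))"
    by (rule sum.swap)
  also have "\<dots> = S" unfolding S_def
    by (intro sum.cong refl) (use symA in auto)
  finally have "S \<in> \<real>" by (simp add: Reals_cnj_iff)
  have "\<exists>i<n. v $ i \<noteq> 0"
  proof (rule ccontr)
    assume "\<not> ?thesis"
    then have "v = 0\<^sub>v n" using v(1) by (intro eq_vecI) auto
    then show False using v(2) by simp
  qed
  then obtain i where "i < n" "v $ i \<noteq> 0" by auto
  then have "r > 0" unfolding r_def by (intro sum_pos2[of _ i]) auto
  then have "a = S / complex_of_real r" using S by simp
  then show ?thesis using \<open>S \<in> \<real>\<close> by simp
qed

text \<open>The polynomial factors over the complex numbers with real roots only, and the embedding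
  of real into complex polynomials is injective.\<close>

lemma symmetric_char_poly_splits:
  fixes A :: "real mat"
  assumes A: "A \<in> carrier_mat n n" and sym: "transpose_mat A = A"
  shows "\<exists>es. char_poly A = (\<Prod>a\<leftarrow>es. [:- a, 1:])"
proof -
  let ?A = "map_mat complex_of_real A"
  have A': "?A \<in> carrier_mat n n" using A by simp
  obtain as where as: "char_poly ?A = (\<Prod>a\<leftarrow>as. [:- a, 1:])"
    using char_poly_factorized[OF A'] by blast
  have real: "a \<in> \<real>" if "a \<in> set as" for a
  proof -
    have "poly (char_poly ?A) a = 0" unfolding as using that
      by (auto simp: poly_prod_list prod_list_zero_iff image_iff)
    then show ?thesis
      using symmetric_complex_eigenvalue_real[OF A sym] eigenvalue_root_char_poly[OF A'] by blast
  qed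
  define es where "es = map Re as"
  interpret h: map_poly_inj_comm_ring_hom complex_of_real ..
  have "map_poly complex_of_real (char_poly A) = char_poly ?A"
    by (rule of_real_hom.char_poly_hom[OF A, symmetric])
  also have "\<dots> = (\<Prod>a\<leftarrow>es. [:- complex_of_real a, 1:])"
    unfolding as es_def map_map
    by (rule arg_cong[of _ _ prod_list], rule map_cong) (use real in auto)
  also have "\<dots> = map_poly complex_of_real (\<Prod>a\<leftarrow>es. [:- a, 1:])"
    by (simp add: h.hom_prod_list o_def)
  finally show ?thesis by auto
qed

lemma jordan_matrix_unit_blocks:
  "i < length es \<Longrightarrow> j < length es \<Longrightarrow>
    jordan_matrix (map (Pair 1) es) $$ (i, j) = (if i = j then es ! i else (0::'a::comm_ring_1))"
proof (induction es arbitrary: i j)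
  case (Cons e es)
  have s: "sum_list (map fst (map (Pair (Suc 0)) es)) = length es"
    by (induction es) auto
  have J: "jordan_matrix (map (Pair (Suc 0)) es) \<in> carrier_mat (length es) (length es)"
    using jordan_matrix_carrier[of "map (Pair (Suc 0)) es"] unfolding s .
  show ?case
    using Cons.prems J Cons.IH[of "i - 1" "j - 1"]
    by (auto simp del: map_map simp: jordan_matrix_Cons s nth_Cons' jordan_block_def)
qed simp

text \<open>If \<open>C\<close> annihilates \<open>C v\<close>, then by symmetry the squared norm of
  \<open>C v\<close> is the product of \<open>C (C v)\<close> with \<open>v\<close>, which is
  zero.\<close>

lemma symmetric_kernel_square:
  fixes C :: "real mat"
  assumes C: "C \<in> carrier_mat n n" and sym: "transpose_mat C = C"
  shows "mat_kernel (C ^\<^sub>m 2) = mat_kernel (C ^\<^sub>m 1)"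
proof -
  have C2: "C ^\<^sub>m 2 = C * C" using C by (simp add: numeral_2_eq_2)
  have C1: "C ^\<^sub>m 1 = C" using C by simp
  have "C *\<^sub>v v = 0\<^sub>v n" if v: "v \<in> carrier_vec n" and "(C * C) *\<^sub>v v = 0\<^sub>v n" for v
  proof -
    have "(C *\<^sub>v v) \<bullet> (C *\<^sub>v v) = (transpose_mat C *\<^sub>v (C *\<^sub>v v)) \<bullet> v"
      using C v by (subst transpose_vec_mult_scalar[of C n n]) auto
    also have "\<dots> = 0" using that C v by (simp add: sym)
    finally have "(C *\<^sub>v v) \<bullet>c (C *\<^sub>v v) = 0" using C v by (simp add: conjugate_vec_def)
    then show ?thesis using C v by (subst (asm) conjugate_square_eq_0_vec[of _ n]) auto
  qed
  then show ?thesis unfolding C2 C1 mat_kernel_def using C by (auto simp: assoc_mult_mat_vec[of _ n n _ n])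
qed

text \<open>Jordan blocks of a symmetric matrix have size one because \<open>ker C\<^sup>2 = ker C\<close> for symmetric \<open>C\<close>.\<close>

lemma symmetric_mat_diagonalization:
  fixes A :: "real mat"
  assumes A: "A \<in> carrier_mat n n" and sym: "transpose_mat A = A"
  obtains es P Q where "length es = n" "proots (char_poly A) = mset es"
    "P \<in> carrier_mat n n" "Q \<in> carrier_mat n n" "P * Q = 1\<^sub>m n" "Q * P = 1\<^sub>m n"
    "A * P = P * mat_diag n (\<lambda>i. es ! i)"
proof -
  obtain as where "char_poly A = (\<Prod>a\<leftarrow>as. [:- a, 1:])"
    using symmetric_char_poly_splits[OF A sym] by blast
  then obtain n_as where jnf: "jordan_nf A n_as" using jordan_nf_exists[OF A] by blast
  have one: "m = 1" if "(m, e) \<in> set n_as" for m e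
  proof -
    let ?C = "char_matrix A e"
    have C: "?C \<in> carrier_mat n n" using A by simp
    have symC: "transpose_mat ?C = ?C"
    proof (rule eq_matI)
      fix i j assume "i < dim_row ?C" "j < dim_col ?C"
      then show "transpose_mat ?C $$ (i, j) = ?C $$ (i, j)"
        using A index_transpose_mat(1)[of i A j] by (auto simp: char_matrix_def sym)
    qed (use C in auto)
    \<comment> \<open>The dimension at exponent \<open>k\<close> is the sum of
      \<open>min k s\<close> over the sizes \<open>s\<close> of the blocks for \<open>e\<close>. The
      summands for \<open>k = 1\<close> never exceed those for \<open>k = 2\<close>, so equal sums
      force \<open>s \<le> 1\<close> for every block.\<close>
    have "dim_gen_eigenspace A e 2 = dim_gen_eigenspace A e 1"
      unfolding dim_gen_eigenspace_def kernel_dim_def symmetric_kernel_square[OF C symC]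
      using C by (simp add: pow_mat_dim)
    then have eq: "(\<Sum>k\<leftarrow>map fst [(k, e')\<leftarrow>n_as. e' = e]. min 2 k)
        = (\<Sum>k\<leftarrow>map fst [(k, e')\<leftarrow>n_as. e' = e]. min 1 k)"
      unfolding dim_gen_eigenspace[OF jnf] .
    have "\<forall>k\<in>set ks. min 2 k = min 1 k" if "(\<Sum>k\<leftarrow>ks. min 2 k) = (\<Sum>k\<leftarrow>ks. min 1 k)" for ks :: "nat list"
      using that
    proof (induction ks)
      case (Cons k ks)
      have "(\<Sum>k\<leftarrow>ks. min 1 k) \<le> (\<Sum>k\<leftarrow>ks. min 2 k)"
        by (rule sum_list_mono) auto
      moreover have "min 1 k \<le> min 2 k" by auto
      ultimately have "min 2 k = min 1 k" "(\<Sum>k\<leftarrow>ks. min 2 k) = (\<Sum>k\<leftarrow>ks. min 1 k)"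
        using Cons.prems by auto
      then show ?case using Cons.IH by auto
    qed simp
    from this[OF eq] have "min 2 m = min 1 m" using that by force
    moreover have "m \<noteq> 0" using jnf that unfolding jordan_nf_def by force
    ultimately show ?thesis by linarith
  qed
  define es where "es = map snd n_as"
  have n_as: "n_as = map (Pair 1) es"
    unfolding es_def map_map by (rule map_idI[symmetric]) (use one in auto)
  have cp: "char_poly A = (\<Prod>a\<leftarrow>es. [:- a, 1:])"
    unfolding jordan_nf_char_poly[OF jnf] n_as by (simp add: o_def)
  have len: "length es = n"
    using degree_monic_char_poly[OF A] degree_linear_factors[of uminus es] cp by simp
  have "proots (\<Prod>a\<leftarrow>es. [:- a, 1:]) = mset es"
  proof (induction es)
    case (Cons e es)
    have "(\<Prod>a\<leftarrow>es. [:- a, 1:]) \<noteq> 0" by (auto simp: prod_list_zero_iff)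
    then have "proots ([:- e, 1:] * (\<Prod>a\<leftarrow>es. [:- a, 1:])) = proots [:- e, 1:] + mset es"
      using Cons by (subst proots_mult) auto
    then show ?case by simp
  qed simp
  then have pr: "proots (char_poly A) = mset es" using cp by simp
  have D: "jordan_matrix n_as = mat_diag n (\<lambda>i. es ! i)"
  proof (rule eq_matI)
    fix i j assume "i < dim_row (mat_diag n (\<lambda>i. es ! i))" "j < dim_col (mat_diag n (\<lambda>i. es ! i))"
    then show "jordan_matrix n_as $$ (i, j) = mat_diag n (\<lambda>i. es ! i) $$ (i, j)"
      unfolding n_as using jordan_matrix_unit_blocks[of i es j] len by (auto simp: mat_diag_def)
  qed (auto simp: n_as len o_def sum_list_triv mat_diag_def)
  obtain P Q where "similar_mat_wit A (jordan_matrix n_as) P Q"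
    using jnf unfolding jordan_nf_def similar_mat_def by blast
  note w = similar_mat_witD2[OF A this, unfolded D]
  have PQ: "P \<in> carrier_mat n n" "Q \<in> carrier_mat n n" "P * Q = 1\<^sub>m n" "Q * P = 1\<^sub>m n"
    and AD: "A = P * mat_diag n (\<lambda>i. es ! i) * Q" by (fact w)+
  have Dc: "mat_diag n (\<lambda>i. es ! i) \<in> carrier_mat n n" by simp
  have "A * P = P * mat_diag n (\<lambda>i. es ! i) * (Q * P)"
    by (subst AD, rule assoc_mult_mat[of _ n n _ n _ n]) (use PQ(1,2) Dc in auto)
  then have "A * P = P * mat_diag n (\<lambda>i. es ! i)" using PQ Dc by simp
  with len pr PQ that show ?thesis by blast
qed

text \<open>Fill the list up to a square matrix whose last row is zero; its determinant vanishes. As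
  \<open>length rs < n\<close>, the zero row replaces none of the equations.\<close>

lemma underdetermined_system:
  fixes rs :: "'a :: field vec list"
  assumes rs: "set rs \<subseteq> carrier_vec n" and len: "length rs < n"
  shows "\<exists>c \<in> carrier_vec n. c \<noteq> 0\<^sub>v n \<and> (\<forall>r\<in>set rs. r \<bullet> c = 0)"
proof -
  define f where "f i = (if i < length rs then rs ! i else 0\<^sub>v n)" for i
  have f: "f i \<in> carrier_vec n" for i using rs unfolding f_def by auto
  define M where "M = mat\<^sub>r n n (\<lambda>i. if i = n - 1 then 0\<^sub>v n else f i)"
  have M: "M \<in> carrier_mat n n" unfolding M_def by simp
  have "det M = 0" unfolding M_def using len f by (intro det_row_0) auto
  then obtain c where c: "c \<in> carrier_vec n" "c \<noteq> 0\<^sub>v n" "M *\<^sub>v c = 0\<^sub>v n"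
    using det_0_iff_vec_prod_zero[OF M] by blast
  have "r \<bullet> c = 0" if r: "r \<in> set rs" for r
  proof -
    obtain i where i: "i < length rs" "r = rs ! i" using r by (auto simp: in_set_conv_nth)
    have "(M *\<^sub>v c) $ i = row M i \<bullet> c" using M i len by simp
    also have "row M i = f i" unfolding M_def using i len f[of i] unfolding f_def
      by (intro eq_vecI) auto
    also have "f i = r" using i by (simp add: f_def)
    finally show ?thesis using c(3) i len by simp
  qed
  then show ?thesis using c by blast
qed

section \<open>Min-max bounds for eigenvalues\<close>

text \<open>Expansion through the Gram matrix of the columns of \<open>P\<close>; pairs of
  orthogonal columns drop out of the double sum.\<close>

lemma mult_mat_vec_scalar_prod:
  fixes P :: "'a :: comm_ring_1 mat"
  assumes P: "P \<in> carrier_mat m n" and a: "a \<in> carrier_vec n" and b: "b \<in> carrier_vec n"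
  shows "(P *\<^sub>v a) \<bullet> (P *\<^sub>v b) = (\<Sum>i<n. \<Sum>j<n. a $ i * b $ j * (col P i \<bullet> col P j))"
proof -
  have "(P *\<^sub>v a) \<bullet> (P *\<^sub>v b)
      = (\<Sum>k<m. (\<Sum>i<n. P $$ (k, i) * a $ i) * (\<Sum>j<n. P $$ (k, j) * b $ j))"
    using assms by (simp add: scalar_prod_def lessThan_atLeast0)
  also have "\<dots> = (\<Sum>k<m. \<Sum>i<n. \<Sum>j<n. a $ i * b $ j * (P $$ (k, i) * P $$ (k, j)))"
    by (simp add: sum_product mult_ac)
  also have "\<dots> = (\<Sum>i<n. \<Sum>k<m. \<Sum>j<n. a $ i * b $ j * (P $$ (k, i) * P $$ (k, j)))"
    by (rule sum.swap)
  also have "\<dots> = (\<Sum>i<n. \<Sum>j<n. \<Sum>k<m. a $ i * b $ j * (P $$ (k, i) * P $$ (k, j)))"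
    by (intro sum.cong refl sum.swap)
  also have "\<dots> = (\<Sum>i<n. \<Sum>j<n. a $ i * b $ j * (col P i \<bullet> col P j))"
    using P by (intro sum.cong refl) (simp add: scalar_prod_def lessThan_atLeast0 sum_distrib_left)
  finally show ?thesis .
qed

lemma real_scalar_prod_pos:
  fixes v :: "real vec"
  assumes "v \<in> carrier_vec n" "v \<noteq> 0\<^sub>v n"
  shows "v \<bullet> v > 0"
  using conjugate_square_greater_0_vec[of v n] assms by (simp add: conjugate_vec_def)

text \<open>The eigenvectors \<open>col P j\<close> need not be orthogonal within an eigenspace. Distributing the
  weight \<open>h (es ! j)\<close> as two square roots still turns the form into a square, since only pairs
  with equal eigenvalues contribute.\<close>

lemma eigenvector_form_pos:
  fixes P :: "real mat"
  assumes P: "P \<in> carrier_mat n n"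
    and inj: "\<And>v. v \<in> carrier_vec n \<Longrightarrow> P *\<^sub>v v = 0\<^sub>v n \<Longrightarrow> v = 0\<^sub>v n"
    and orth: "\<And>i j. i < n \<Longrightarrow> j < n \<Longrightarrow> es ! i \<noteq> es ! j \<Longrightarrow> col P i \<bullet> col P j = 0"
    and c: "c \<in> carrier_vec n" "c \<noteq> 0\<^sub>v n"
    and h: "\<And>j. j < n \<Longrightarrow> c $ j \<noteq> 0 \<Longrightarrow> h (es ! j) > 0"
  shows "(P *\<^sub>v c) \<bullet> (P *\<^sub>v vec n (\<lambda>j. h (es ! j) * c $ j)) > 0"
proof -
  define b where "b = vec n (\<lambda>j. sqrt (h (es ! j)) * c $ j)"
  have b: "b \<in> carrier_vec n" unfolding b_def by simp
  obtain j where j: "j < n" "c $ j \<noteq> 0"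
    using c by (metis carrier_vecD eq_vecI index_zero_vec(1) index_zero_vec(2))
  then have "b $ j \<noteq> 0" unfolding b_def using h[OF j] by simp
  then have "b \<noteq> 0\<^sub>v n" using j by auto
  then have "P *\<^sub>v b \<noteq> 0\<^sub>v n" using inj[OF b] by blast
  then have "(P *\<^sub>v b) \<bullet> (P *\<^sub>v b) > 0" using P b by (intro real_scalar_prod_pos[of _ n]) auto
  also have "(P *\<^sub>v b) \<bullet> (P *\<^sub>v b) = (P *\<^sub>v c) \<bullet> (P *\<^sub>v vec n (\<lambda>j. h (es ! j) * c $ j))"
    unfolding mult_mat_vec_scalar_prod[OF P b b] mult_mat_vec_scalar_prod[OF P c(1) vec_carrier]
  proof (intro sum.cong refl)
    fix i j assume "i \<in> {..<n}" "j \<in> {..<n}"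
    then have ij: "i < n" "j < n" by auto
    show "b $ i * b $ j * (col P i \<bullet> col P j)
      = c $ i * vec n (\<lambda>j. h (es ! j) * c $ j) $ j * (col P i \<bullet> col P j)"
    proof (cases "es ! i = es ! j \<and> c $ j \<noteq> 0")
      case True
      then have "sqrt (h (es ! j)) * sqrt (h (es ! j)) = h (es ! j)" using h[OF ij(2)] by simp
      then have "b $ i * b $ j = c $ i * (h (es ! j) * c $ j)" using True ij unfolding b_def
        by (simp add: mult.assoc mult.left_commute)
      then show ?thesis using ij by simp
    next
      case False
      then show ?thesis using orth[OF ij] ij unfolding b_def by auto
    qed
  qed
  finally show ?thesis .
qed

text \<open>The columns of \<open>P\<close> are eigenvectors, so \<open>A\<close> multiplies the
  \<open>j\<close>-th coordinate by \<open>es ! j\<close>; symmetry makes columns with different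
  eigenvalues orthogonal. The cases \<open>\<beta> = 1\<close> and \<open>\<beta> = - 1\<close>
  serve the upper and the lower min-max bound.\<close>

lemma symmetric_rayleigh_basis:
  fixes A :: "real mat"
  assumes A: "A \<in> carrier_mat n n" and sym: "transpose_mat A = A"
  obtains es P Q where "length es = n" "proots (char_poly A) = mset es"
    "P \<in> carrier_mat n n" "Q \<in> carrier_mat n n" "P * Q = 1\<^sub>m n" "Q * P = 1\<^sub>m n"
    "\<And>c \<alpha> \<beta>. c \<in> carrier_vec n \<Longrightarrow> c \<noteq> 0\<^sub>v n \<Longrightarrow>
      (\<And>j. j < n \<Longrightarrow> c $ j \<noteq> 0 \<Longrightarrow> \<alpha> + \<beta> * es ! j > 0) \<Longrightarrow>
      \<alpha> * ((P *\<^sub>v c) \<bullet> (P *\<^sub>v c)) + \<beta> * ((P *\<^sub>v c) \<bullet> (A *\<^sub>v (P *\<^sub>v c))) > 0"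
proof -
  obtain es P Q where es: "length es = n" "proots (char_poly A) = mset es"
    and P: "P \<in> carrier_mat n n" and Q: "Q \<in> carrier_mat n n"
    and PQ: "P * Q = 1\<^sub>m n" "Q * P = 1\<^sub>m n"
    and AP: "A * P = P * mat_diag n (\<lambda>i. es ! i)"
    using symmetric_mat_diagonalization[OF A sym] by blast
  have inj: "v = 0\<^sub>v n" if v: "v \<in> carrier_vec n" "P *\<^sub>v v = 0\<^sub>v n" for v
  proof -
    have "v = (Q * P) *\<^sub>v v" using PQ v by simp
    also have "\<dots> = Q *\<^sub>v (P *\<^sub>v v)" using P Q v by (simp add: assoc_mult_mat_vec[of _ n n _ n])
    also have "\<dots> = 0\<^sub>v n" using Q unfolding v(2) by auto
    finally show ?thesis .
  qed
  have col: "A *\<^sub>v col P j = es ! j \<cdot>\<^sub>v col P j" if "j < n" for j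
  proof -
    have "A *\<^sub>v col P j = col (A * P) j" by (rule col_mult2[OF A P that, symmetric])
    also have "\<dots> = es ! j \<cdot>\<^sub>v col P j"
      unfolding AP mat_diag_mult_right[OF P] using P that by (intro eq_vecI) auto
    finally show ?thesis .
  qed
  have orth: "col P i \<bullet> col P j = 0" if "i < n" "j < n" "es ! i \<noteq> es ! j" for i j
  proof -
    have ci: "col P i \<in> carrier_vec n" and cj: "col P j \<in> carrier_vec n" using P by auto
    have "es ! i * (col P i \<bullet> col P j) = (transpose_mat A *\<^sub>v col P i) \<bullet> col P j"
      unfolding sym col[OF that(1)] using ci cj by simp
    also have "\<dots> = col P i \<bullet> (A *\<^sub>v col P j)"
      by (rule transpose_vec_mult_scalar[OF A cj ci])
    also have "\<dots> = es ! j * (col P i \<bullet> col P j)"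
      unfolding col[OF that(2)] using ci cj by simp
    finally show ?thesis using that(3) by simp
  qed
  have "\<alpha> * ((P *\<^sub>v c) \<bullet> (P *\<^sub>v c)) + \<beta> * ((P *\<^sub>v c) \<bullet> (A *\<^sub>v (P *\<^sub>v c))) > 0"
    if c: "c \<in> carrier_vec n" "c \<noteq> 0\<^sub>v n"
      and pos: "\<And>j. j < n \<Longrightarrow> c $ j \<noteq> 0 \<Longrightarrow> \<alpha> + \<beta> * es ! j > 0" for c \<alpha> \<beta>
  proof -
    let ?D = "mat_diag n (\<lambda>i. es ! i)"
    have D: "?D \<in> carrier_mat n n" by simp
    have Dc: "?D *\<^sub>v c = vec n (\<lambda>j. es ! j * c $ j)"
    proof (rule eq_vecI)
      fix i assume "i < dim_vec (vec n (\<lambda>j. es ! j * c $ j))"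
      then have i: "i < n" by simp
      have "(?D *\<^sub>v c) $ i = (\<Sum>j\<in>{0..<n}. (if i = j then es ! j else 0) * c $ j)"
        using i c by (simp add: mat_diag_def scalar_prod_def)
      also have "\<dots> = (\<Sum>j\<in>{0..<n}. if i = j then es ! j * c $ j else 0)"
        by (rule sum.cong) auto
      finally show "(?D *\<^sub>v c) $ i = vec n (\<lambda>j. es ! j * c $ j) $ i" using i by simp
    qed (simp add: mat_diag_def)
    have "A *\<^sub>v (P *\<^sub>v c) = (A * P) *\<^sub>v c" using A P c by simp
    also have "\<dots> = P *\<^sub>v (?D *\<^sub>v c)" unfolding AP using P D c by (simp add: assoc_mult_mat_vec[of _ n n _ n])
    finally have APc: "A *\<^sub>v (P *\<^sub>v c) = P *\<^sub>v vec n (\<lambda>j. es ! j * c $ j)" unfolding Dc .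
    have "vec n (\<lambda>j. (\<alpha> + \<beta> * es ! j) * c $ j) = \<alpha> \<cdot>\<^sub>v c + \<beta> \<cdot>\<^sub>v vec n (\<lambda>j. es ! j * c $ j)"
      using c by (intro eq_vecI) (auto simp: algebra_simps)
    then have "P *\<^sub>v vec n (\<lambda>j. (\<alpha> + \<beta> * es ! j) * c $ j) = \<alpha> \<cdot>\<^sub>v (P *\<^sub>v c) + \<beta> \<cdot>\<^sub>v (A *\<^sub>v (P *\<^sub>v c))"
      unfolding APc using P c by (simp add: mult_add_distrib_mat_vec[of _ n n] mult_mat_vec[of _ n n])
    moreover have "P *\<^sub>v c \<in> carrier_vec n" "A *\<^sub>v (P *\<^sub>v c) \<in> carrier_vec n" using A P c by auto
    ultimately have "(P *\<^sub>v c) \<bullet> (P *\<^sub>v vec n (\<lambda>j. (\<alpha> + \<beta> * es ! j) * c $ j))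
      = \<alpha> * ((P *\<^sub>v c) \<bullet> (P *\<^sub>v c)) + \<beta> * ((P *\<^sub>v c) \<bullet> (A *\<^sub>v (P *\<^sub>v c)))"
      by (simp add: scalar_prod_add_distrib[of _ n])
    then show ?thesis
      using eigenvector_form_pos[OF P inj _ c, where es = es and h = "\<lambda>e. \<alpha> + \<beta> * e"] pos orth by simp
  qed
  with es P Q PQ that show ?thesis by blast
qed

section \<open>Counting eigenvalues on either side of a threshold\<close>

lemma length_filter_eq_sort: "length (filter p xs) = length (filter p (sort xs))"
  by (metis mset_filter mset_sort size_mset)

lemma length_filter_upt_nth: "length (filter (\<lambda>j. p (xs ! j)) [0..<length xs]) = length (filter p xs)"
proof -
  have "filter p xs = filter p (map ((!) xs) [0..<length xs])" by (simp add: map_nth)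
  then show ?thesis by (simp add: filter_map o_def)
qed

text \<open>In sorted order the entries up to \<open>\<mu>\<close> all stand before position
  \<open>k\<close>, with positions counted from 0.\<close>

lemma sorted_nth_gt_filter_le:
  fixes xs :: "'a :: linorder list"
  assumes "k < length xs" "sort xs ! k > \<mu>"
  shows "length (filter (\<lambda>x. x \<le> \<mu>) xs) \<le> k"
proof -
  have "{i. i < length (sort xs) \<and> sort xs ! i \<le> \<mu>} \<subseteq> {..<k}"
  proof safe
    fix i assume i: "i < length (sort xs)" "sort xs ! i \<le> \<mu>"
    show "i < k"
    proof (rule ccontr)
      assume "\<not> i < k"
      then have "sort xs ! k \<le> sort xs ! i" using i by (intro sorted_nth_mono) auto
      then show False using i assms by auto
    qed
  qed
  from card_mono[OF _ this] show ?thesis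
    by (subst length_filter_eq_sort) (simp add: length_filter_conv_card)
qed

lemma sorted_nth_less_filter_ge:
  fixes xs :: "'a :: linorder list"
  assumes "k < length xs" "sort xs ! k < \<mu>"
  shows "length (filter (\<lambda>x. \<not> x < \<mu>) xs) < length xs - k"
proof -
  have "{i. i < length (sort xs) \<and> \<not> sort xs ! i < \<mu>} \<subseteq> {Suc k..<length xs}"
  proof safe
    fix i assume i: "i < length (sort xs)" "\<not> sort xs ! i < \<mu>"
    have "\<not> i \<le> k"
    proof
      assume "i \<le> k"
      then have "sort xs ! i \<le> sort xs ! k" using assms by (intro sorted_nth_mono) auto
      then show False using i assms by auto
    qed
    then show "i \<in> {Suc k..<length xs}" using i by auto
  qed
  from card_mono[OF _ this] show ?thesis
    using assms(1) by (subst length_filter_eq_sort) (simp add: length_filter_conv_card)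
qed

text \<open>Courant-Fischer from above. If the eigenvalue exceeded \<open>\<mu>\<close>, fewer than
  \<open>k\<close> eigenvectors in the basis would have eigenvalue at most \<open>\<mu>\<close>.
  Some nonzero vector in the \<open>k\<close>-dimensional range of \<open>W\<close> has no component
  along them, so its Rayleigh quotient exceeds \<open>\<mu>\<close>.\<close>

lemma nth_eigenvalue_le:
  fixes A :: "real mat"
  assumes A: "A \<in> carrier_mat n n" and sym: "transpose_mat A = A"
    and k: "0 < k" "k \<le> n" and W: "W \<in> carrier_mat n k"
    and inj: "\<And>c. c \<in> carrier_vec k \<Longrightarrow> W *\<^sub>v c = 0\<^sub>v n \<Longrightarrow> c = 0\<^sub>v k"
    and bound: "\<And>c. c \<in> carrier_vec k \<Longrightarrow>
      (W *\<^sub>v c) \<bullet> (A *\<^sub>v (W *\<^sub>v c)) \<le> \<mu> * ((W *\<^sub>v c) \<bullet> (W *\<^sub>v c))"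
  shows "nth_eigenvalue k A \<le> \<mu>"
proof (rule ccontr)
  assume gt: "\<not> ?thesis"
  obtain es P Q where es: "length es = n" "proots (char_poly A) = mset es"
    and P: "P \<in> carrier_mat n n" and Q: "Q \<in> carrier_mat n n"
    and PQ: "P * Q = 1\<^sub>m n" "Q * P = 1\<^sub>m n"
    and pos: "\<And>c \<alpha> \<beta>. c \<in> carrier_vec n \<Longrightarrow> c \<noteq> 0\<^sub>v n \<Longrightarrow>
      (\<And>j. j < n \<Longrightarrow> c $ j \<noteq> 0 \<Longrightarrow> \<alpha> + \<beta> * es ! j > 0) \<Longrightarrow>
      \<alpha> * ((P *\<^sub>v c) \<bullet> (P *\<^sub>v c)) + \<beta> * ((P *\<^sub>v c) \<bullet> (A *\<^sub>v (P *\<^sub>v c))) > 0"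
    using symmetric_rayleigh_basis[OF A sym] by metis
  have ev: "nth_eigenvalue k A = sort es ! (k - 1)" unfolding nth_eigenvalue_def es by simp
  define S where "S = filter (\<lambda>j. es ! j \<le> \<mu>) [0..<n]"
  \<comment> \<open>\<open>nth_eigenvalue\<close> numbers from 1 and list positions start at 0,
    hence \<open>k - 1\<close>.\<close>
  have "length S \<le> k - 1"
    unfolding S_def using sorted_nth_gt_filter_le[of "k - 1" es \<mu>] gt ev k es(1)
      length_filter_upt_nth[of "\<lambda>x. x \<le> \<mu>" es] by auto
  then have len: "length (map (row (Q * W)) S) < k" using k by simp
  have QW: "Q * W \<in> carrier_mat n k" using Q W by simp
  have rows: "set (map (row (Q * W)) S) \<subseteq> carrier_vec k" using W by (auto intro!: carrier_vecI)
  obtain c where c: "c \<in> carrier_vec k" "c \<noteq> 0\<^sub>v k"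
    and c0: "\<And>j. j \<in> set S \<Longrightarrow> row (Q * W) j \<bullet> c = 0"
    using underdetermined_system[OF rows len] by auto
  \<comment> \<open>\<open>Q\<close> inverts \<open>P\<close>, so \<open>z\<close> holds the
    coordinates of \<open>W c\<close> in the eigenvector basis; by the choice of \<open>c\<close>
    those in \<open>S\<close> vanish.\<close>
  define z where "z = (Q * W) *\<^sub>v c"
  have z: "z \<in> carrier_vec n" unfolding z_def using QW c by auto
  have Wc: "W *\<^sub>v c \<in> carrier_vec n" using W c by auto
  have "P *\<^sub>v z = P *\<^sub>v (Q *\<^sub>v (W *\<^sub>v c))"
    unfolding z_def using Q W c by (simp add: assoc_mult_mat_vec[of _ n n _ k])
  also have "\<dots> = (P * Q) *\<^sub>v (W *\<^sub>v c)"
    using P Q Wc by (simp add: assoc_mult_mat_vec[of _ n n _ n])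
  finally have Pz: "P *\<^sub>v z = W *\<^sub>v c" unfolding PQ using Wc by simp
  have "z \<noteq> 0\<^sub>v n"
  proof
    assume "z = 0\<^sub>v n"
    moreover have "P *\<^sub>v 0\<^sub>v n = 0\<^sub>v n" using P by auto
    ultimately have "W *\<^sub>v c = 0\<^sub>v n" using Pz by simp
    then show False using inj c by blast
  qed
  moreover have "- \<mu> + 1 * es ! j > 0" if "j < n" "z $ j \<noteq> 0" for j
  proof (rule ccontr)
    assume "\<not> ?thesis"
    then have "j \<in> set S" unfolding S_def using that by auto
    then have "z $ j = 0" using c0[of j] QW that(1) unfolding z_def by auto
    then show False using that by simp
  qed
  ultimately have "- \<mu> * ((P *\<^sub>v z) \<bullet> (P *\<^sub>v z)) + 1 * ((P *\<^sub>v z) \<bullet> (A *\<^sub>v (P *\<^sub>v z))) > 0"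
    by (intro pos[OF z]) auto
  then show False using bound[OF c(1)] unfolding Pz by simp
qed

text \<open>The dual bound. If the eigenvalue were below \<open>\<mu>\<close>, at most
  \<open>n - k\<close> eigenvalues would be at least \<open>\<mu>\<close>. Annihilating their
  coordinates and satisfying the \<open>k - 1\<close> equations of \<open>Z\<close> leaves a nonzero
  vector, with Rayleigh quotient below \<open>\<mu>\<close>.\<close>

lemma nth_eigenvalue_ge:
  fixes A :: "real mat"
  assumes A: "A \<in> carrier_mat n n" and sym: "transpose_mat A = A"
    and k: "0 < k" "k \<le> n" and Z: "Z \<in> carrier_mat (k - 1) n"
    and bound: "\<And>y. y \<in> carrier_vec n \<Longrightarrow> Z *\<^sub>v y = 0\<^sub>v (k - 1) \<Longrightarrow> \<mu> * (y \<bullet> y) \<le> y \<bullet> (A *\<^sub>v y)"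
  shows "\<mu> \<le> nth_eigenvalue k A"
proof (rule ccontr)
  assume less: "\<not> ?thesis"
  obtain es P Q where es: "length es = n" "proots (char_poly A) = mset es"
    and P: "P \<in> carrier_mat n n" and Q: "Q \<in> carrier_mat n n"
    and PQ: "P * Q = 1\<^sub>m n" "Q * P = 1\<^sub>m n"
    and pos: "\<And>c \<alpha> \<beta>. c \<in> carrier_vec n \<Longrightarrow> c \<noteq> 0\<^sub>v n \<Longrightarrow>
      (\<And>j. j < n \<Longrightarrow> c $ j \<noteq> 0 \<Longrightarrow> \<alpha> + \<beta> * es ! j > 0) \<Longrightarrow>
      \<alpha> * ((P *\<^sub>v c) \<bullet> (P *\<^sub>v c)) + \<beta> * ((P *\<^sub>v c) \<bullet> (A *\<^sub>v (P *\<^sub>v c))) > 0"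
    using symmetric_rayleigh_basis[OF A sym] by metis
  have ev: "nth_eigenvalue k A = sort es ! (k - 1)" unfolding nth_eigenvalue_def es by simp
  define S where "S = filter (\<lambda>j. \<not> es ! j < \<mu>) [0..<n]"
  have S: "length S < n - (k - 1)"
    unfolding S_def using sorted_nth_less_filter_ge[of "k - 1" es \<mu>] less ev k es(1)
      length_filter_upt_nth[of "\<lambda>x. \<not> x < \<mu>" es] by auto
  \<comment> \<open>The unknown is the coordinate vector \<open>c\<close>: the unit vectors
    annihilate its entries in \<open>S\<close>, and the rows of \<open>Z * P\<close> express that
    \<open>Z\<close> annihilates \<open>P c\<close>.\<close>
  define rs where "rs = map (unit_vec n) S @ rows (Z * P)"
  have ZP: "Z * P \<in> carrier_mat (k - 1) n" using Z P by simp
  have len: "length rs < n" unfolding rs_def using S Z k by simp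
  have rows: "set rs \<subseteq> carrier_vec n" using P unfolding rs_def by (auto simp: rows_def intro!: carrier_vecI)
  obtain c where c: "c \<in> carrier_vec n" "c \<noteq> 0\<^sub>v n" and c0: "\<And>r. r \<in> set rs \<Longrightarrow> r \<bullet> c = 0"
    using underdetermined_system[OF rows len] by auto
  have "Z *\<^sub>v (P *\<^sub>v c) = (Z * P) *\<^sub>v c" using Z P c by simp
  also have "\<dots> = 0\<^sub>v (k - 1)"
    using ZP c0 unfolding rs_def by (intro eq_vecI) (auto simp: rows_def)
  finally have ZPc: "Z *\<^sub>v (P *\<^sub>v c) = 0\<^sub>v (k - 1)" .
  have "\<mu> + (- 1) * es ! j > 0" if "j < n" "c $ j \<noteq> 0" for j
  proof (rule ccontr)
    assume "\<not> ?thesis"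
    then have "j \<in> set S" unfolding S_def using that by auto
    then have "unit_vec n j \<bullet> c = 0" using c0 unfolding rs_def by simp
    then show False using that c by simp
  qed
  then have "\<mu> * ((P *\<^sub>v c) \<bullet> (P *\<^sub>v c)) + (- 1) * ((P *\<^sub>v c) \<bullet> (A *\<^sub>v (P *\<^sub>v c))) > 0"
    by (intro pos[OF c]) auto
  then show False using bound[OF _ ZPc] P c by auto
qed

section \<open>The stiffness form as a sum of Laplacian forms\<close>

lemma linf_norm_ge: "i < dim_vec x \<Longrightarrow> \<bar>x $ i\<bar> \<le> linf_norm x"
  unfolding linf_norm_def by (intro Max_ge) auto

lemma linf_norm_eqI:
  assumes "i < dim_vec x" "\<And>j. j < dim_vec x \<Longrightarrow> \<bar>x $ j\<bar> \<le> \<bar>x $ i\<bar>"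
  shows "linf_norm x = \<bar>x $ i\<bar>"
  unfolding linf_norm_def using assms by (intro Max_eqI) auto

text \<open>The same definite description as inside \<open>support_functional\<close>, whose axis
  thereby becomes the colour of the edge.\<close>

definition dominant_axis :: "nat \<Rightarrow> ('v \<Rightarrow> real vec) \<Rightarrow> 'v \<Rightarrow> 'v \<Rightarrow> nat" where
  "dominant_axis d p v w = (THE i. i < d \<and> \<bar>(p v - p w) $ i\<bar> = linf_norm (p v - p w))"

text \<open>The monochromatic subgraph of colour \<open>i\<close>.\<close>

definition axis_adj :: "nat \<Rightarrow> 'v set set \<Rightarrow> ('v \<Rightarrow> real vec) \<Rightarrow> nat \<Rightarrow> 'v \<Rightarrow> 'v \<Rightarrow> bool" where
  "axis_adj d E p i v w \<longleftrightarrow> {v, w} \<in> E \<and> dominant_axis d p v w = i"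

text \<open>Twice the Laplacian quadratic form of the graph with adjacency relation \<open>R\<close>: every edge is
  counted in both directions.\<close>

definition energy :: "'v set \<Rightarrow> ('v \<Rightarrow> 'v \<Rightarrow> bool) \<Rightarrow> ('v \<Rightarrow> real) \<Rightarrow> real" where
  "energy V R x = (\<Sum>v\<in>V. \<Sum>w\<in>V. if R v w then (x v - x w)\<^sup>2 else 0)"

text \<open>The form as an equivalence yields both the unique existence required of placements and
  the value of the definite description.\<close>

lemma unique_dominant_axis:
  assumes "dim_vec x = d" "i < d" "\<And>j. j < d \<Longrightarrow> j \<noteq> i \<Longrightarrow> \<bar>x $ j\<bar> < \<bar>x $ i\<bar>"
  shows "(j < d \<and> \<bar>x $ j\<bar> = linf_norm x) \<longleftrightarrow> j = i"
proof -
  have "linf_norm x = \<bar>x $ i\<bar>" using assms by (intro linf_norm_eqI) (auto, metis less_eq_real_def)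
  then show ?thesis using assms by force
qed

lemma dominant_axis_eqI:
  assumes "p w \<in> carrier_vec d" "i < d"
    "\<And>j. j < d \<Longrightarrow> j \<noteq> i \<Longrightarrow> \<bar>(p v - p w) $ j\<bar> < \<bar>(p v - p w) $ i\<bar>"
  shows "dominant_axis d p v w = i"
  unfolding dominant_axis_def using unique_dominant_axis[of "p v - p w" d i] assms by simp

text \<open>Double counting: the map from ordered pairs to unordered ones has exactly two preimages
  over each edge.\<close>

lemma sum_over_edges:
  fixes f :: "'v set \<Rightarrow> real"
  assumes "simple_graph V E"
  shows "2 * (\<Sum>e\<in>E. f e) = (\<Sum>v\<in>V. \<Sum>w\<in>V. if {v, w} \<in> E then f {v, w} else 0)"
proof -
  have V: "finite V" and E: "E \<subseteq> [V]\<^bsup>2\<^esup>" using assms unfolding simple_graph_def by auto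
  have finE: "finite E" using E V finite_imp_finite_nsets finite_subset by blast
  define P where "P = {q \<in> V \<times> V. {fst q, snd q} \<in> E}"
  have P: "finite P" unfolding P_def using V by simp
  have fiber: "(\<Sum>q\<in>{q \<in> P. {fst q, snd q} = e}. f {fst q, snd q}) = 2 * f e" if eE: "e \<in> E" for e
  proof -
    have "e \<subseteq> V" "card e = 2" using eE E unfolding nsets_def by auto
    then obtain a b where e: "e = {a, b}" "a \<noteq> b" "a \<in> V" "b \<in> V" by (auto simp: card_2_iff)
    have "{q \<in> P. {fst q, snd q} = e} = {(a, b), (b, a)}"
      unfolding P_def using eE e by (auto simp: doubleton_eq_iff insert_commute)
    then show ?thesis using e by (simp add: insert_commute)
  qed
  have "(\<Sum>v\<in>V. \<Sum>w\<in>V. if {v, w} \<in> E then f {v, w} else 0)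
      = (\<Sum>q\<in>V \<times> V. if {fst q, snd q} \<in> E then f {fst q, snd q} else 0)"
    by (simp add: sum.cartesian_product case_prod_beta)
  also have "\<dots> = (\<Sum>q\<in>P. f {fst q, snd q})"
    unfolding P_def using V by (intro sum.inter_filter[symmetric]) simp
  also have "\<dots> = (\<Sum>e\<in>E. \<Sum>q\<in>{q \<in> P. {fst q, snd q} = e}. f {fst q, snd q})"
    by (intro sum.group[symmetric] P finE) (auto simp: P_def)
  also have "\<dots> = (\<Sum>e\<in>E. 2 * f e)" using fiber by (intro sum.cong) auto
  finally show ?thesis by (simp add: sum_distrib_left)
qed

lemma enum_list:
  assumes "finite A"
  shows "set (enum_list A) = A" "distinct (enum_list A)" "length (enum_list A) = card A"
proof -
  have "\<exists>xs. set xs = A \<and> distinct xs" using finite_distinct_list[OF assms] by blast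
  from someI_ex[OF this] show *: "set (enum_list A) = A" "distinct (enum_list A)"
    unfolding enum_list_def by auto
  show "length (enum_list A) = card A" using * distinct_card by metis
qed

lemma bij_betw_enum_list: "finite A \<Longrightarrow> bij_betw (\<lambda>k. enum_list A ! k) {..<card A} A"
  using enum_list[of A] by (intro bij_betw_nth) auto

locale framework =
  fixes d :: nat and V :: "'v set" and E :: "'v set set" and p :: "'v \<Rightarrow> real vec"
  assumes graph: "simple_graph V E" and d: "d \<ge> 2" and placement: "p \<in> placements d V E"
begin

abbreviation "adj \<equiv> axis_adj d E p"
abbreviation "L \<equiv> stiffness_matrix d V E p"

lemma finite_V: "finite V" and finite_E: "finite E"
  using graph finite_imp_finite_nsets finite_subset unfolding simple_graph_def by blast+

lemma edgeD: "{v, w} \<in> E \<Longrightarrow> v \<in> V \<and> w \<in> V \<and> v \<noteq> w"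
  using graph unfolding simple_graph_def nsets_def by (cases "v = w") auto

lemma p_carrier: "v \<in> V \<Longrightarrow> p v \<in> carrier_vec d"
  using placement unfolding placements_def by auto

lemma dominant_axis:
  assumes "{v, w} \<in> E"
  shows "dominant_axis d p v w < d"
    "j < d \<Longrightarrow> j \<noteq> dominant_axis d p v w \<Longrightarrow>
      \<bar>(p v - p w) $ j\<bar> < \<bar>(p v - p w) $ dominant_axis d p v w\<bar>"
proof -
  let ?x = "p v - p w"
  have dim: "dim_vec ?x = d" using p_carrier edgeD[OF assms] by auto
  have ex: "\<exists>!i. i < d \<and> \<bar>?x $ i\<bar> = linf_norm ?x"
    using assms placement unfolding placements_def by blast
  from theI'[OF this] have *: "dominant_axis d p v w < d"
    "\<bar>?x $ dominant_axis d p v w\<bar> = linf_norm ?x" unfolding dominant_axis_def by auto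
  show "dominant_axis d p v w < d" by (rule *)
  assume "j < d" "j \<noteq> dominant_axis d p v w"
  moreover from this have "\<bar>?x $ j\<bar> \<noteq> linf_norm ?x" using ex * by blast
  ultimately show "\<bar>?x $ j\<bar> < \<bar>?x $ dominant_axis d p v w\<bar>"
    using linf_norm_ge[of j ?x] dim * by simp
qed

text \<open>As \<open>d \<ge> 2\<close>, there is another axis, and the dominant entry strictly
  exceeds its nonnegative absolute value.\<close>

lemma dominant_axis_nonzero:
  assumes "{v, w} \<in> E" shows "(p v - p w) $ dominant_axis d p v w \<noteq> 0"
proof -
  define j where "j = (if dominant_axis d p v w = 0 then 1 else 0 :: nat)"
  have "j < d" "j \<noteq> dominant_axis d p v w" using d unfolding j_def by auto
  then show ?thesis using dominant_axis(2)[OF assms, of j] by auto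
qed

lemma diff_swap: "v \<in> V \<Longrightarrow> w \<in> V \<Longrightarrow> i < d \<Longrightarrow> (p w - p v) $ i = - ((p v - p w) $ i)"
  using p_carrier[of v] p_carrier[of w] by auto

lemma dominant_axis_commute:
  assumes "{v, w} \<in> E"
  shows "dominant_axis d p w v = dominant_axis d p v w"
proof (rule dominant_axis_eqI)
  have vw: "v \<in> V" "w \<in> V" using edgeD assms by auto
  then show "p v \<in> carrier_vec d" using p_carrier by auto
  show "dominant_axis d p v w < d" by (rule dominant_axis(1)[OF assms])
  fix j assume "j < d" "j \<noteq> dominant_axis d p v w"
  then show "\<bar>(p w - p v) $ j\<bar> < \<bar>(p w - p v) $ dominant_axis d p v w\<bar>"
    using dominant_axis[OF assms] diff_swap[OF vw] by auto
qed

lemma adj_commute: "adj i v w \<longleftrightarrow> adj i w v"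
  unfolding axis_adj_def using dominant_axis_commute by (metis insert_commute)

lemma adjD: "adj i v w \<Longrightarrow> v \<in> V \<and> w \<in> V \<and> v \<noteq> w \<and> i < d"
  unfolding axis_adj_def using edgeD dominant_axis(1) by blast

section \<open>Block vectors as families of functions on the vertices\<close>

definition vertex_index :: "'v \<Rightarrow> nat" where
  "vertex_index = inv_into {..<card V} (\<lambda>k. enum_list V ! k)"

text \<open>The layout is that of the columns of \<open>rigidity_matrix\<close>. For fixed
  \<open>i\<close> this is a function on \<open>V\<close>, to which the Laplacian form of colour
  \<open>i\<close> applies.\<close>

definition coord :: "real vec \<Rightarrow> 'v \<Rightarrow> nat \<Rightarrow> real" where
  "coord y v i = y $ (d * vertex_index v + i)"

lemma vertex_index: "v \<in> V \<Longrightarrow> vertex_index v < card V"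
  "v \<in> V \<Longrightarrow> enum_list V ! vertex_index v = v"
  "k < card V \<Longrightarrow> vertex_index (enum_list V ! k) = k"
proof -
  note b = bij_betw_enum_list[OF finite_V]
  show "v \<in> V \<Longrightarrow> vertex_index v < card V"
    unfolding vertex_index_def using b bij_betw_imp_surj_on inv_into_into by (metis lessThan_iff)
  show "v \<in> V \<Longrightarrow> enum_list V ! vertex_index v = v"
    unfolding vertex_index_def using b by (simp add: bij_betw_inv_into_right)
  show "k < card V \<Longrightarrow> vertex_index (enum_list V ! k) = k"
    unfolding vertex_index_def using b by (simp add: bij_betw_inv_into_left)
qed

lemma block_index: "k < card V \<Longrightarrow> i < d \<Longrightarrow> d * k + i < d * card V"
proof -
  assume "k < card V" "i < d"
  then have "d * k + i < d * Suc k" by simp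
  also have "\<dots> \<le> d * card V" using \<open>k < card V\<close> by (intro mult_le_mono2) simp
  finally show ?thesis .
qed

lemma sum_blocks:
  fixes f :: "nat \<Rightarrow> 'a::comm_monoid_add"
  shows "(\<Sum>c<d * card V. f c) = (\<Sum>v\<in>V. \<Sum>i<d. f (d * vertex_index v + i))"
proof -
  have "(\<Sum>v\<in>V. \<Sum>i<d. f (d * vertex_index v + i))
      = (\<Sum>k<card V. \<Sum>i<d. f (d * vertex_index (enum_list V ! k) + i))"
    by (rule sum.reindex_bij_betw[OF bij_betw_enum_list[OF finite_V], symmetric])
  also have "\<dots> = (\<Sum>k<card V. \<Sum>i<d. f (d * k + i))"
    using vertex_index(3) by (intro sum.cong) auto
  also have "\<dots> = (\<Sum>k<card V. sum f {k * d..<k * d + d})"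
  proof (rule sum.cong[OF refl])
    fix k
    show "(\<Sum>i<d. f (d * k + i)) = sum f {k * d..<k * d + d}"
      using sum.shift_bounds_nat_ivl[of f 0 "k * d" d]
      by (simp add: lessThan_atLeast0 add.commute mult.commute)
  qed
  also have "\<dots> = (\<Sum>c<d * card V. f c)" by (simp add: sum.nat_group mult.commute)
  finally show ?thesis by simp
qed

lemma scalar_prod_coord:
  assumes "x \<in> carrier_vec (d * card V)" "y \<in> carrier_vec (d * card V)"
  shows "x \<bullet> y = (\<Sum>v\<in>V. \<Sum>i<d. coord x v i * coord y v i)"
proof -
  have "x \<bullet> y = (\<Sum>c<d * card V. x $ c * y $ c)"
    using assms by (simp add: scalar_prod_def lessThan_atLeast0)
  then show ?thesis unfolding sum_blocks coord_def .
qed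

text \<open>The two support functionals at the ends are opposite unit vectors along the dominant
  axis, so the row yields a coordinate difference up to sign. Squaring removes the sign and makes
  the statement independent of the orientation.\<close>

lemma rigidity_row:
  assumes y: "y \<in> carrier_vec (d * card V)" and r: "r < card E"
    and e: "enum_list E ! r = {a, b}" "{a, b} \<in> E"
  shows "((rigidity_matrix d V E p *\<^sub>v y) $ r)\<^sup>2
    = (coord y a (dominant_axis d p a b) - coord y b (dominant_axis d p a b))\<^sup>2"
proof -
  define i where "i = dominant_axis d p a b"
  have ab: "a \<in> V" "b \<in> V" "a \<noteq> b" using edgeD[OF e(2)] by auto
  have i: "i < d" unfolding i_def using dominant_axis[OF e(2)] by blast
  define g where "g v j = (if v \<in> {a, b} then support_functional d p v (THE x. {a, b} = {v, x}) $ j else 0)" for v j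
  have "(rigidity_matrix d V E p *\<^sub>v y) $ r = (\<Sum>c<d * card V. g (enum_list V ! (c div d)) (c mod d) * y $ c)"
    using y r unfolding rigidity_matrix_def g_def e(1)[symmetric]
    by (simp add: scalar_prod_def lessThan_atLeast0 Let_def)
  also have "\<dots> = (\<Sum>v\<in>V. \<Sum>j<d. g v j * coord y v j)"
    unfolding sum_blocks coord_def using vertex_index(2) by (intro sum.cong) auto
  also have "\<dots> = (\<Sum>v\<in>{a, b}. \<Sum>j<d. g v j * coord y v j)"
    using ab finite_V by (intro sum.mono_neutral_right) (auto simp: g_def)
  also have "\<dots> = (\<Sum>j<d. g a j * coord y a j) + (\<Sum>j<d. g b j * coord y b j)" using ab by simp
  also have "(\<Sum>j<d. g a j * coord y a j) = sgn ((p a - p b) $ i) * coord y a i"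
  proof -
    have "(THE x. {a, b} = {a, x}) = b" by (rule the_equality) (use ab in \<open>auto simp: doubleton_eq_iff\<close>)
    then have "g a j = sgn ((p a - p b) $ i) * (if j = i then 1 else 0)" if "j < d" for j
      using that unfolding g_def support_functional_def i_def dominant_axis_def Let_def
      by (auto simp: unit_vec_def)
    then have "(\<Sum>j<d. g a j * coord y a j) = (\<Sum>j<d. if j = i then sgn ((p a - p b) $ i) * coord y a j else 0)"
      by (intro sum.cong) auto
    then show ?thesis using i by simp
  qed
  also have "(\<Sum>j<d. g b j * coord y b j) = - sgn ((p a - p b) $ i) * coord y b i"
  proof -
    have "(THE x. {a, b} = {b, x}) = a" by (rule the_equality) (use ab in \<open>auto simp: doubleton_eq_iff\<close>)
    moreover have "dominant_axis d p b a = i" unfolding i_def by (rule dominant_axis_commute[OF e(2)])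
    ultimately have "g b j = sgn ((p b - p a) $ i) * (if j = i then 1 else 0)" if "j < d" for j
      using that unfolding g_def support_functional_def dominant_axis_def Let_def
      by (auto simp: unit_vec_def)
    then have "g b j = - sgn ((p a - p b) $ i) * (if j = i then 1 else 0)" if "j < d" for j
      using that diff_swap[OF ab(1,2) i] by (simp add: sgn_minus)
    then have "(\<Sum>j<d. g b j * coord y b j) = (\<Sum>j<d. if j = i then - sgn ((p a - p b) $ i) * coord y b j else 0)"
      by (intro sum.cong) auto
    then show ?thesis using i by simp
  qed
  finally have "(rigidity_matrix d V E p *\<^sub>v y) $ r = sgn ((p a - p b) $ i) * (coord y a i - coord y b i)"
    by (simp add: algebra_simps)
  moreover have "(sgn ((p a - p b) $ i))\<^sup>2 = 1"
    using dominant_axis_nonzero[OF e(2)] unfolding i_def[symmetric] by (simp add: sgn_if)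
  ultimately show ?thesis unfolding i_def by (simp add: power_mult_distrib)
qed

lemma rigidity_carrier: "rigidity_matrix d V E p \<in> carrier_mat (card E) (d * card V)"
  unfolding rigidity_matrix_def by simp

lemma stiffness_carrier: "L \<in> carrier_mat (d * card V) (d * card V)"
  unfolding stiffness_matrix_def using rigidity_carrier by auto

lemma stiffness_symmetric: "transpose_mat L = L"
  unfolding stiffness_matrix_def using rigidity_carrier
  by (subst transpose_mult) auto

text \<open>The form of \<open>L\<close> at \<open>y\<close> is the squared norm of the image of
  \<open>y\<close> under the rigidity matrix: one square per edge, involving only the axis of its
  colour. Sorting edges by colour gives the direct sum; the factor 2 matches the double count in
  \<open>energy\<close>.\<close>

lemma stiffness_form:
  assumes y: "y \<in> carrier_vec (d * card V)"
  shows "2 * (y \<bullet> (L *\<^sub>v y)) = (\<Sum>i<d. energy V (adj i) (\<lambda>v. coord y v i))"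
proof -
  let ?R = "rigidity_matrix d V E p"
  have Ry: "?R *\<^sub>v y \<in> carrier_vec (card E)" using rigidity_carrier y by auto
  \<comment> \<open>The inverse of the edge enumeration, so that the sum over rows becomes a sum
    over edges.\<close>
  define r where "r = inv_into {..<card E} (\<lambda>k. enum_list E ! k)"
  define F where "F e = ((?R *\<^sub>v y) $ (r e))\<^sup>2" for e
  note b = bij_betw_enum_list[OF finite_E]
  have r: "r e < card E" "enum_list E ! r e = e" if "e \<in> E" for e
    unfolding r_def using b that
    by (metis bij_betw_imp_surj_on inv_into_into lessThan_iff, simp add: bij_betw_inv_into_right)
  have F: "F {v, w} = (coord y v (dominant_axis d p v w) - coord y w (dominant_axis d p v w))\<^sup>2"
    if "{v, w} \<in> E" for v w
    unfolding F_def using rigidity_row[OF y r[OF that] that] .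
  have "y \<bullet> (L *\<^sub>v y) = y \<bullet> (transpose_mat ?R *\<^sub>v (?R *\<^sub>v y))"
    unfolding stiffness_matrix_def using rigidity_carrier y
    by (subst assoc_mult_mat_vec[of _ "d * card V" "card E" _ "d * card V"]) auto
  also have "\<dots> = (transpose_mat ?R *\<^sub>v (?R *\<^sub>v y)) \<bullet> y"
    using rigidity_carrier y by (intro comm_scalar_prod[of _ "d * card V"]) auto
  also have "\<dots> = (?R *\<^sub>v y) \<bullet> (?R *\<^sub>v y)"
    by (rule transpose_vec_mult_scalar[OF rigidity_carrier y Ry])
  also have "\<dots> = (\<Sum>k<card E. ((?R *\<^sub>v y) $ k)\<^sup>2)"
    using rigidity_carrier by (simp add: scalar_prod_def power2_eq_square lessThan_atLeast0 del: index_mult_mat_vec)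
  also have "\<dots> = (\<Sum>k<card E. F (enum_list E ! k))"
    unfolding F_def r_def using bij_betw_inv_into_left[OF b] by (intro sum.cong) auto
  also have "\<dots> = (\<Sum>e\<in>E. F e)" by (rule sum.reindex_bij_betw[OF b])
  finally have "2 * (y \<bullet> (L *\<^sub>v y)) = (\<Sum>v\<in>V. \<Sum>w\<in>V. if {v, w} \<in> E then F {v, w} else 0)"
    using sum_over_edges[OF graph, of F] by simp
  also have "\<dots> = (\<Sum>v\<in>V. \<Sum>w\<in>V. \<Sum>i<d. if adj i v w then (coord y v i - coord y w i)\<^sup>2 else 0)"
  proof (intro sum.cong refl)
    fix v w
    show "(if {v, w} \<in> E then F {v, w} else 0)
      = (\<Sum>i<d. if adj i v w then (coord y v i - coord y w i)\<^sup>2 else 0)"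
    proof (cases "{v, w} \<in> E")
      case True
      have "(\<Sum>i<d. if adj i v w then (coord y v i - coord y w i)\<^sup>2 else 0)
        = (\<Sum>i<d. if i = dominant_axis d p v w then (coord y v i - coord y w i)\<^sup>2 else 0)"
        using True unfolding axis_adj_def by (intro sum.cong) auto
      then show ?thesis using True F[OF True] dominant_axis(1)[OF True] by simp
    qed (simp add: axis_adj_def)
  qed
  also have "\<dots> = (\<Sum>v\<in>V. \<Sum>i<d. \<Sum>w\<in>V. if adj i v w then (coord y v i - coord y w i)\<^sup>2 else 0)"
    by (intro sum.cong refl sum.swap)
  also have "\<dots> = (\<Sum>i<d. energy V (adj i) (\<lambda>v. coord y v i))"
    unfolding energy_def by (rule sum.swap)
  finally show ?thesis .
qed

text \<open>The test space is spanned by the \<open>d\<close> translations, on which the form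
  vanishes, and by \<open>x\<close> placed on axis \<open>i\<close>. As \<open>x\<close> sums to
  zero it is orthogonal to the translations, so the dimension is \<open>d + 1\<close>.\<close>

lemma nth_eigenvalue_stiffness_le:
  assumes n: "card V \<ge> d + 1" and i: "i < d" and x0: "(\<Sum>v\<in>V. x v) = 0"
    and u: "u \<in> V" "x u \<noteq> 0" and \<mu>: "0 \<le> \<mu>"
    and bound: "energy V (adj i) x \<le> 2 * \<mu> * (\<Sum>v\<in>V. (x v)\<^sup>2)"
  shows "nth_eigenvalue (d + 1) L \<le> \<mu>"
proof -
  let ?N = "d * card V"
  \<comment> \<open>Column \<open>j < d\<close> is the translation along axis \<open>j\<close>;
    column \<open>d\<close> carries \<open>x\<close> on axis \<open>i\<close>.\<close>
  define W where "W = mat ?N (d + 1) (\<lambda>(r, j). if j = d then if r mod d = i then x (enum_list V ! (r div d)) else 0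
      else if r mod d = j then 1 else 0)"
  have W: "W \<in> carrier_mat ?N (d + 1)" unfolding W_def by simp
  have dN: "d + 1 \<le> ?N"
  proof -
    have "2 * (d + 1) \<le> d * card V" using d n by (intro mult_le_mono) auto
    then show ?thesis by simp
  qed
  have coordW: "coord (W *\<^sub>v c) v j = c $ j + (if j = i then c $ d * x v else 0)"
    if c: "c \<in> carrier_vec (d + 1)" and v: "v \<in> V" and j: "j < d" for c v j
  proof -
    let ?r = "d * vertex_index v + j"
    have r: "?r < ?N" using block_index[OF vertex_index(1)] v j by simp
    have "(W *\<^sub>v c) $ ?r = (\<Sum>l<d + 1. W $$ (?r, l) * c $ l)"
      using r c W by (simp add: scalar_prod_def lessThan_atLeast0)
    also have "\<dots> = (\<Sum>l<d. W $$ (?r, l) * c $ l) + W $$ (?r, d) * c $ d" by simp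
    also have "(\<Sum>l<d. W $$ (?r, l) * c $ l) = (\<Sum>l<d. if l = j then c $ l else 0)"
      using r j unfolding W_def by (intro sum.cong) auto
    also have "\<dots> = c $ j" using j by simp
    also have "W $$ (?r, d) * c $ d = (if j = i then c $ d * x v else 0)"
      using r j v vertex_index(2) unfolding W_def by auto
    finally show ?thesis unfolding coord_def .
  qed
  let ?X = "\<Sum>v\<in>V. (x v)\<^sup>2"
  have X: "?X > 0" using u finite_V by (intro sum_pos2[of _ u]) auto
  have Wc: "W *\<^sub>v c \<in> carrier_vec ?N" if "c \<in> carrier_vec (d + 1)" for c using W that by auto
  have norm: "(W *\<^sub>v c) \<bullet> (W *\<^sub>v c) = card V * (\<Sum>j<d. (c $ j)\<^sup>2) + (c $ d)\<^sup>2 * ?X"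
    if c: "c \<in> carrier_vec (d + 1)" for c
  proof -
    have "(W *\<^sub>v c) \<bullet> (W *\<^sub>v c) = (\<Sum>v\<in>V. \<Sum>j<d. (c $ j + (if j = i then c $ d * x v else 0))\<^sup>2)"
      unfolding scalar_prod_coord[OF Wc[OF c] Wc[OF c]] using coordW[OF c]
      by (intro sum.cong) (auto simp: power2_eq_square)
    also have "\<dots> = (\<Sum>v\<in>V. \<Sum>j<d. (c $ j)\<^sup>2 + (if j = i then 2 * c $ i * c $ d * x v + (c $ d)\<^sup>2 * (x v)\<^sup>2 else 0))"
      by (intro sum.cong refl) (auto simp: power2_eq_square algebra_simps)
    also have "\<dots> = (\<Sum>v\<in>V. (\<Sum>j<d. (c $ j)\<^sup>2) + 2 * c $ i * c $ d * x v + (c $ d)\<^sup>2 * (x v)\<^sup>2)"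
      using i by (simp add: sum.distrib)
    also have "\<dots> = card V * (\<Sum>j<d. (c $ j)\<^sup>2) + 2 * c $ i * c $ d * (\<Sum>v\<in>V. x v) + (c $ d)\<^sup>2 * ?X"
      by (simp add: sum.distrib sum_distrib_left)
    finally show ?thesis using x0 by simp
  qed
  show ?thesis
  proof (rule nth_eigenvalue_le[OF stiffness_carrier stiffness_symmetric _ dN W])
    fix c :: "real vec" assume c: "c \<in> carrier_vec (d + 1)"
    show "c = 0\<^sub>v (d + 1)" if "W *\<^sub>v c = 0\<^sub>v ?N"
    proof -
      have "card V * (\<Sum>j<d. (c $ j)\<^sup>2) + (c $ d)\<^sup>2 * ?X = 0"
        using norm[OF c] unfolding that by simp
      moreover have "card V * (\<Sum>j<d. (c $ j)\<^sup>2) \<ge> 0" "(c $ d)\<^sup>2 * ?X \<ge> 0"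
        using X by (auto intro!: mult_nonneg_nonneg sum_nonneg)
      ultimately have "card V * (\<Sum>j<d. (c $ j)\<^sup>2) = 0" "(c $ d)\<^sup>2 * ?X = 0" by linarith+
      then have "(\<Sum>j<d. (c $ j)\<^sup>2) = 0" "c $ d = 0" using X n by auto
      then have "c $ j = 0" if "j < d + 1" for j
        using that by (cases "j = d") (auto simp: sum_nonneg_eq_0_iff)
      then show ?thesis using c by (intro eq_vecI) auto
    qed
    have "energy V (adj j) (\<lambda>v. coord (W *\<^sub>v c) v j) = (if j = i then (c $ d)\<^sup>2 * energy V (adj i) x else 0)"
      if "j < d" for j
    proof -
      have "energy V (adj j) (\<lambda>v. coord (W *\<^sub>v c) v j)
        = (\<Sum>v\<in>V. \<Sum>w\<in>V. if j = i then (c $ d)\<^sup>2 * (if adj i v w then (x v - x w)\<^sup>2 else 0) else 0)"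
        unfolding energy_def using coordW[OF c _ that]
        by (intro sum.cong refl) (auto simp: power2_eq_square algebra_simps)
      then show ?thesis unfolding energy_def by (simp add: sum_distrib_left)
    qed
    then have "2 * ((W *\<^sub>v c) \<bullet> (L *\<^sub>v (W *\<^sub>v c))) = (c $ d)\<^sup>2 * energy V (adj i) x"
      unfolding stiffness_form[OF Wc[OF c]] using i by simp
    also have "\<dots> \<le> (c $ d)\<^sup>2 * (2 * \<mu> * ?X)" using bound by (intro mult_left_mono) auto
    \<comment> \<open>The translations contribute to the norm only; adding their share on the right
      uses \<open>0 \<le> \<mu>\<close>.\<close>
    also have "\<dots> \<le> 2 * \<mu> * ((W *\<^sub>v c) \<bullet> (W *\<^sub>v c))"
    proof -
      have "(c $ d)\<^sup>2 * ?X \<le> (W *\<^sub>v c) \<bullet> (W *\<^sub>v c)"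
        unfolding norm[OF c] by (auto intro!: mult_nonneg_nonneg sum_nonneg)
      then have "2 * \<mu> * ((c $ d)\<^sup>2 * ?X) \<le> 2 * \<mu> * ((W *\<^sub>v c) \<bullet> (W *\<^sub>v c))"
        using \<mu> by (intro mult_left_mono) auto
      then show ?thesis by (simp add: mult_ac)
    qed
    finally show "(W *\<^sub>v c) \<bullet> (L *\<^sub>v (W *\<^sub>v c)) \<le> \<mu> * ((W *\<^sub>v c) \<bullet> (W *\<^sub>v c))" by simp
  qed simp
qed

text \<open>Min-max with the \<open>d\<close> equations saying that the coordinates of
  \<open>y\<close> sum to zero along each axis; the gap hypothesis then applies to every colour
  separately.\<close>

lemma nth_eigenvalue_stiffness_ge:
  assumes n: "card V \<ge> d + 1"
    and gap: "\<And>i x. i < d \<Longrightarrow> (\<Sum>v\<in>V. x v) = 0 \<Longrightarrow> 2 * \<mu> * (\<Sum>v\<in>V. (x v)\<^sup>2) \<le> energy V (adj i) x"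
  shows "\<mu> \<le> nth_eigenvalue (d + 1) L"
proof -
  let ?N = "d * card V"
  define Z where "Z = mat d ?N (\<lambda>(j, r). if r mod d = j then 1 else (0::real))"
  have Z: "Z \<in> carrier_mat (d + 1 - 1) ?N" unfolding Z_def by simp
  have dN: "d + 1 \<le> ?N"
  proof -
    have "2 * (d + 1) \<le> d * card V" using d n by (intro mult_le_mono) auto
    then show ?thesis by simp
  qed
  show ?thesis
  proof (rule nth_eigenvalue_ge[OF stiffness_carrier stiffness_symmetric _ dN Z])
    fix y :: "real vec" assume y: "y \<in> carrier_vec ?N" and Zy: "Z *\<^sub>v y = 0\<^sub>v (d + 1 - 1)"
    have zero: "(\<Sum>v\<in>V. coord y v j) = 0" if j: "j < d" for j
    proof -
      have "(Z *\<^sub>v y) $ j = (\<Sum>r<?N. (if r mod d = j then 1 else 0) * y $ r)"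
        using y j unfolding Z_def by (simp add: scalar_prod_def lessThan_atLeast0)
      also have "\<dots> = (\<Sum>v\<in>V. \<Sum>i<d. if i = j then coord y v i else 0)"
        unfolding sum_blocks coord_def by (intro sum.cong) auto
      also have "\<dots> = (\<Sum>v\<in>V. coord y v j)" using j by simp
      finally show ?thesis using Zy j by simp
    qed
    have "2 * (\<mu> * (y \<bullet> y)) = 2 * \<mu> * (\<Sum>v\<in>V. \<Sum>i<d. (coord y v i)\<^sup>2)"
      unfolding scalar_prod_coord[OF y y] by (simp add: power2_eq_square)
    also have "\<dots> = (\<Sum>i<d. 2 * \<mu> * (\<Sum>v\<in>V. (coord y v i)\<^sup>2))"
      by (subst sum.swap) (simp add: sum_distrib_left)
    also have "\<dots> \<le> (\<Sum>i<d. energy V (adj i) (\<lambda>v. coord y v i))"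
      using gap zero by (intro sum_mono) auto
    also have "\<dots> = 2 * (y \<bullet> (L *\<^sub>v y))" by (rule stiffness_form[OF y, symmetric])
    finally show "\<mu> * (y \<bullet> y) \<le> y \<bullet> (L *\<^sub>v y)" by simp
  qed simp
qed

lemma energy_nonneg: "energy V R x \<ge> 0"
  unfolding energy_def by (intro sum_nonneg) auto

text \<open>A violating \<open>x\<close> would be a test vector for
  \<open>nth_eigenvalue_stiffness_le\<close>, with \<open>\<mu>\<close> its Rayleigh quotient, which
  is below 1.\<close>

lemma spectral_gap:
  assumes n: "card V \<ge> d + 1" and one: "nth_eigenvalue (d + 1) L \<ge> 1"
    and i: "i < d" and x0: "(\<Sum>v\<in>V. x v) = 0"
  shows "energy V (adj i) x \<ge> 2 * (\<Sum>v\<in>V. (x v)\<^sup>2)"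
proof (rule ccontr)
  assume less: "\<not> ?thesis"
  let ?X = "\<Sum>v\<in>V. (x v)\<^sup>2"
  have X: "?X > 0" using less energy_nonneg[of "adj i" x] by linarith
  then obtain u where "u \<in> V" "x u \<noteq> 0"
    by (metis (no_types, lifting) less_irrefl sum.neutral zero_power2)
  moreover define \<mu> where "\<mu> = energy V (adj i) x / (2 * ?X)"
  moreover have "\<mu> \<ge> 0" unfolding \<mu>_def using X energy_nonneg by simp
  moreover have "energy V (adj i) x \<le> 2 * \<mu> * ?X" unfolding \<mu>_def using X by simp
  ultimately have "nth_eigenvalue (d + 1) L \<le> \<mu>"
    using nth_eigenvalue_stiffness_le[OF n i x0] by blast
  moreover have "\<mu> < 1" unfolding \<mu>_def using X less by simp
  ultimately show False using one by simp
qed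

end

section \<open>Spectral gaps of graphs\<close>

definition neighbours :: "'v set \<Rightarrow> ('v \<Rightarrow> 'v \<Rightarrow> bool) \<Rightarrow> 'v \<Rightarrow> 'v set" where
  "neighbours V R v = {w \<in> V. R v w}"

locale symmetric_relation =
  fixes V :: "'v set" and R :: "'v \<Rightarrow> 'v \<Rightarrow> bool"
  assumes fin: "finite V" and sym: "R v w \<Longrightarrow> R w v" and irrefl: "\<not> R v v"
begin

abbreviation "nb \<equiv> neighbours V R"

lemma finite_nb: "finite (nb v)" unfolding neighbours_def using fin by simp

lemma energy_neighbours: "energy V R x = 2 * (\<Sum>v\<in>V. x v * (\<Sum>w\<in>nb v. x v - x w))"
proof -
  define S where "S = (\<Sum>v\<in>V. \<Sum>w\<in>V. if R v w then x v * (x v - x w) else 0)"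
  have "energy V R x = (\<Sum>v\<in>V. \<Sum>w\<in>V. (if R v w then x v * (x v - x w) else 0)
      + (if R w v then x w * (x w - x v) else 0))"
    unfolding energy_def using sym
    by (intro sum.cong refl) (auto simp: power2_eq_square algebra_simps)
  also have "\<dots> = S + (\<Sum>v\<in>V. \<Sum>w\<in>V. if R w v then x w * (x w - x v) else 0)"
    unfolding S_def by (simp add: sum.distrib)
  also have "(\<Sum>v\<in>V. \<Sum>w\<in>V. if R w v then x w * (x w - x v) else 0) = S"
    unfolding S_def by (rule sum.swap)
  also have "S = (\<Sum>v\<in>V. x v * (\<Sum>w\<in>nb v. x v - x w))"
    unfolding S_def neighbours_def sum_distrib_left using fin
    by (intro sum.cong refl sum.inter_filter[symmetric])
  finally show ?thesis by simp
qed

text \<open>A vector that is constant off an isolated \<open>u\<close> has energy zero; the value at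
  \<open>u\<close> is chosen to make the sum zero.\<close>

lemma gap_no_isolated:
  assumes gap: "\<And>x. (\<Sum>v\<in>V. x v) = 0 \<Longrightarrow> 2 * (\<Sum>v\<in>V. (x v)\<^sup>2) \<le> energy V R x"
    and n: "card V \<ge> 2" and u: "u \<in> V"
  shows "nb u \<noteq> {}"
proof
  assume iso: "nb u = {}"
  define x where "x v = (if v = u then real (card V) - 1 else - 1)" for v
  have "(\<Sum>v\<in>V. x v) = x u + (\<Sum>v\<in>V - {u}. x v)" using fin u by (simp add: sum.remove)
  also have "(\<Sum>v\<in>V - {u}. x v) = (\<Sum>v\<in>V - {u}. - 1)" unfolding x_def by (intro sum.cong) auto
  also have "x u + \<dots> = 0" unfolding x_def using fin u n by (simp add: of_nat_diff)
  finally have "2 * (\<Sum>v\<in>V. (x v)\<^sup>2) \<le> energy V R x" by (rule gap)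
  also have "energy V R x = 0"
    unfolding energy_def
  proof (intro sum.neutral ballI)
    fix v w assume vw: "v \<in> V" "w \<in> V"
    show "(if R v w then (x v - x w)\<^sup>2 else 0) = 0"
    proof (cases "R v w")
      case True
      then have "v \<noteq> u" "w \<noteq> u" using iso sym vw unfolding neighbours_def by auto
      then show ?thesis unfolding x_def by simp
    qed simp
  qed
  finally have "(\<Sum>v\<in>V. (x v)\<^sup>2) \<le> 0" by simp
  moreover have "(\<Sum>v\<in>V. (x v)\<^sup>2) > 0"
    using fin u n by (intro sum_pos2[of _ u]) (auto simp: x_def)
  ultimately show False by simp
qed

text \<open>The test vector lives on the leaf \<open>u\<close> and on the vertices other than \<open>u\<close> and its
  neighbour \<open>c\<close>; removing \<open>c\<close> disconnects these two parts.\<close>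

lemma gap_leaf_neighbour:
  assumes gap: "\<And>x. (\<Sum>v\<in>V. x v) = 0 \<Longrightarrow> 2 * (\<Sum>v\<in>V. (x v)\<^sup>2) \<le> energy V R x"
    and u: "u \<in> V" and c: "nb u = {c}"
  shows "nb c = V - {c}"
proof -
  define B where "B = V - {u, c}"
  \<comment> \<open>The value at \<open>u\<close> that balances the entries \<open>- 1\<close> on
    \<open>B\<close>.\<close>
  define m where "m = real (card B)"
  define x where "x v = (if v = u then m else if v = c then 0 else - 1)" for v
  have cV: "c \<in> V" "R u c" "R c u" using c sym unfolding neighbours_def by auto
  have uc: "u \<noteq> c" using cV irrefl by auto
  have V: "V = insert u (insert c B)" using u cV unfolding B_def by auto
  have B: "finite B" "u \<notin> B" "c \<notin> B" unfolding B_def using fin by auto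
  have split: "(\<Sum>v\<in>V. g v) = g u + g c + (\<Sum>v\<in>B. g v)" for g :: "'v \<Rightarrow> real"
    using B uc by (simp add: V add.assoc)
  have xB: "x v = - 1" if "v \<in> B" for v using that B unfolding x_def by auto
  have xu: "x u = m" and xc: "x c = 0" using uc unfolding x_def by auto
  have "(\<Sum>v\<in>V. x v) = 0" unfolding split using xB xu xc by (simp add: m_def)
  then have "2 * (\<Sum>v\<in>V. (x v)\<^sup>2) \<le> energy V R x" by (rule gap)
  also have "(\<Sum>v\<in>V. (x v)\<^sup>2) = m\<^sup>2 + m" unfolding split using xB xu xc by (simp add: m_def)
  also have "energy V R x = 2 * (m\<^sup>2 + card (nb c \<inter> B))"
  proof -
    \<comment> \<open>From a vertex of \<open>B\<close> only the edge to \<open>c\<close> changes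
      the value: \<open>x\<close> is constant on \<open>B\<close>, and \<open>u\<close> has no
      neighbour but \<open>c\<close>.\<close>
    have "x v * (\<Sum>w\<in>nb v. x v - x w) = (if R c v then 1 else 0)" if v: "v \<in> B" for v
    proof -
      have "x v * (\<Sum>w\<in>nb v. x v - x w) = (\<Sum>w\<in>nb v. if w = c then 1 else 0)"
        unfolding sum_distrib_left
      proof (rule sum.cong[OF refl])
        fix w assume w: "w \<in> nb v"
        have "w \<noteq> u"
        proof
          assume "w = u"
          then have "v \<in> nb u" using w v sym unfolding neighbours_def B_def by auto
          then show False using c v B by auto
        qed
        then show "x v * (x v - x w) = (if w = c then 1 else 0)"
          using xB[OF v] unfolding x_def by auto
      qed
      also have "\<dots> = (if c \<in> nb v then 1 else 0)" using finite_nb by simp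
      also have "c \<in> nb v \<longleftrightarrow> R c v" using cV sym unfolding neighbours_def by auto
      finally show ?thesis .
    qed
    then have "(\<Sum>v\<in>B. x v * (\<Sum>w\<in>nb v. x v - x w)) = (\<Sum>v\<in>B. if R c v then 1 else 0)"
      by (rule sum.cong[OF refl])
    also have "\<dots> = card {v \<in> B. R c v}" using B by (simp add: sum.inter_filter[symmetric])
    also have "{v \<in> B. R c v} = nb c \<inter> B" unfolding neighbours_def B_def by auto
    finally show ?thesis unfolding energy_neighbours split c using xu xc by (simp add: power2_eq_square)
  qed
  \<comment> \<open>The gap inequality reads
    \<open>m\<^sup>2 + m \<le> m\<^sup>2 + card (nb c \<inter> B)\<close>.\<close>
  finally have "card B \<le> card (nb c \<inter> B)" unfolding m_def by simp
  then have "nb c \<inter> B = B" using B by (intro card_seteq) auto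
  then show ?thesis using V cV irrefl unfolding neighbours_def by auto
qed

text \<open>The test vector is supported on two adjacent vertices \<open>a\<close>, \<open>b\<close> and on the vertices at
  distance at least two from both.\<close>

lemma two_regular_test_vector:
  assumes reg: "\<And>v. v \<in> V \<Longrightarrow> card (nb v) = 2" and n: "card V \<ge> 6"
  obtains x u where "(\<Sum>v\<in>V. x v) = 0" "u \<in> V" "x u \<noteq> 0"
    "energy V R x \<le> 2 * (\<Sum>v\<in>V. (x v)\<^sup>2)"
    "card V \<ge> 7 \<Longrightarrow> energy V R x < 2 * (\<Sum>v\<in>V. (x v)\<^sup>2)"
proof -
  obtain a where a: "a \<in> V" using n by fastforce
  obtain b a' where nba: "nb a = {b, a'}" "b \<noteq> a'" using reg[OF a] by (auto simp: card_2_iff)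
  have b: "b \<in> V" "R a b" "R b a" and a': "a' \<in> V" "R a a'" "R a' a"
    using nba sym unfolding neighbours_def by auto
  have "a \<in> nb b" using a b unfolding neighbours_def by auto
  then obtain b' where nbb: "nb b = {a, b'}" "b' \<noteq> a"
    using reg[OF b(1)] by (auto simp: card_2_iff doubleton_eq_iff)
  have b': "b' \<in> V" "R b b'" "R b' b" using nbb sym unfolding neighbours_def by auto
  have ne: "a \<noteq> b" "a \<noteq> a'" "b \<noteq> b'" using b a' b' irrefl by auto
  define N where "N = {a', b'}"
  define B where "B = V - {a, b, a', b'}"
  define m where "m = real (card B)"
  \<comment> \<open>The value \<open>- 2\<close> on the \<open>m\<close> vertices of
    \<open>B\<close> balances the value \<open>m\<close> at both \<open>a\<close> and
    \<open>b\<close>.\<close>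
  define x where "x v = (if v \<in> {a, b} then m else if v \<in> N then 0 else - 2)" for v
  have V: "V = {a, b} \<union> (N \<union> B)" using a b a' b' unfolding N_def B_def by auto
  have B: "finite B" "a \<notin> B" "b \<notin> B" "B \<inter> N = {}" unfolding B_def N_def using fin by auto
  have N: "finite N" "a \<notin> N" "b \<notin> N" unfolding N_def using ne nba nbb by auto
  have split: "(\<Sum>v\<in>V. g v) = g a + g b + (\<Sum>v\<in>N. g v) + (\<Sum>v\<in>B. g v)" for g :: "'v \<Rightarrow> real"
  proof -
    have "(\<Sum>v\<in>V. g v) = (\<Sum>v\<in>{a, b}. g v) + (\<Sum>v\<in>N \<union> B. g v)"
      unfolding V using N B by (intro sum.union_disjoint) auto
    also have "(\<Sum>v\<in>N \<union> B. g v) = (\<Sum>v\<in>N. g v) + (\<Sum>v\<in>B. g v)"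
      using N B by (intro sum.union_disjoint) auto
    finally show ?thesis using ne by simp
  qed
  \<comment> \<open>Only an inequality, since \<open>a'\<close> and \<open>b'\<close> coincide if
    \<open>a\<close> and \<open>b\<close> lie in a triangle.\<close>
  have cardB: "card V \<le> card B + 4"
  proof -
    have "V = {a, b, a', b'} \<union> B" using V unfolding N_def by auto
    then have "card V \<le> card {a, b, a', b'} + card B" using card_Un_le by metis
    moreover have "card {a, b, a', b'} \<le> 4" using card_length[of "[a, b, a', b']"] by simp
    ultimately show ?thesis by simp
  qed
  have xB: "x v = - 2" if "v \<in> B" for v using that B unfolding x_def by auto
  have xN: "x v = 0" if "v \<in> N" for v using that N unfolding x_def by auto
  have xa: "x a = m" and xb: "x b = m" unfolding x_def by auto
  have sum0: "(\<Sum>v\<in>V. x v) = 0" unfolding split using xB xN xa xb by (simp add: m_def)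
  have norm: "(\<Sum>v\<in>V. (x v)\<^sup>2) = 2 * m\<^sup>2 + 4 * m" unfolding split using xB xN xa xb by (simp add: m_def)
  have "(\<Sum>w\<in>nb a. x a - x w) = m" unfolding nba(1) using nba(2) xa xb xN[of a'] by (simp add: N_def)
  moreover have "(\<Sum>w\<in>nb b. x b - x w) = m" unfolding nbb(1) using nbb(2) xa xb xN[of b'] by (simp add: N_def)
  moreover have "(\<Sum>v\<in>N. x v * (\<Sum>w\<in>nb v. x v - x w)) = 0" using xN by (intro sum.neutral) auto
  moreover have "(\<Sum>v\<in>B. x v * (\<Sum>w\<in>nb v. x v - x w)) \<le> 8"
  proof -
    have "x v * (\<Sum>w\<in>nb v. x v - x w) = (\<Sum>w\<in>N. if R w v then 4 else 0)" if v: "v \<in> B" for v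
    proof -
      have "x v * (\<Sum>w\<in>nb v. x v - x w) = (\<Sum>w\<in>nb v. if w \<in> N then 4 else 0)"
        unfolding sum_distrib_left
      proof (rule sum.cong[OF refl])
        fix w assume w: "w \<in> nb v"
        have "v \<in> nb w" using w v sym unfolding neighbours_def B_def by auto
        then have "w \<noteq> a" "w \<noteq> b" using nba nbb v unfolding B_def by auto
        then show "x v * (x v - x w) = (if w \<in> N then 4 else 0)"
          using xB[OF v] unfolding x_def by auto
      qed
      also have "\<dots> = (\<Sum>w\<in>nb v \<inter> N. 4)" by (rule sum.inter_restrict[OF finite_nb, symmetric])
      also have "nb v \<inter> N = {w \<in> N. R w v}" using sym V unfolding neighbours_def by auto
      also have "(\<Sum>w\<in>{w \<in> N. R w v}. 4) = (\<Sum>w\<in>N. if R w v then 4 else (0::real))"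
        by (rule sum.inter_filter[OF N(1)])
      finally show ?thesis .
    qed
    then have "(\<Sum>v\<in>B. x v * (\<Sum>w\<in>nb v. x v - x w)) = (\<Sum>v\<in>B. \<Sum>w\<in>N. if R w v then 4 else 0)"
      by (rule sum.cong[OF refl])
    also have "\<dots> = (\<Sum>w\<in>N. \<Sum>v\<in>B. if R w v then 4 else 0)" by (rule sum.swap)
    also have "\<dots> = (\<Sum>w\<in>N. 4 * real (card (nb w \<inter> B)))"
    proof (rule sum.cong[OF refl])
      fix w
      have "nb w \<inter> B = {v \<in> B. R w v}" unfolding neighbours_def B_def by auto
      then show "(\<Sum>v\<in>B. if R w v then 4 else 0) = 4 * real (card (nb w \<inter> B))"
        using B by (simp add: sum.inter_filter[symmetric])
    qed
    \<comment> \<open>One of the two neighbours of \<open>w\<close> is \<open>a\<close> or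
      \<open>b\<close>, so at most one lies in \<open>B\<close>.\<close>
    also have "\<dots> \<le> (\<Sum>w\<in>N. 4)"
    proof (rule sum_mono)
      fix w assume w: "w \<in> N"
      then have wV: "w \<in> V" using V by auto
      obtain y where y: "y \<in> {a, b}" "R w y" using w a' b' unfolding N_def by auto
      have "nb w \<inter> B \<subseteq> nb w - {y}" using y B by auto
      then have "card (nb w \<inter> B) \<le> card (nb w - {y})" using finite_nb by (intro card_mono) auto
      also have "\<dots> = 1" using y a b reg[OF wV] finite_nb unfolding neighbours_def
        by (subst card_Diff_singleton) auto
      finally show "4 * real (card (nb w \<inter> B)) \<le> 4" by simp
    qed
    also have "\<dots> \<le> 8" unfolding N_def by (cases "a' = b'") auto
    finally show ?thesis .
  qed
  ultimately have e: "energy V R x \<le> 2 * (2 * m\<^sup>2 + 8)"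
    unfolding energy_neighbours split using xa xb by (simp add: power2_eq_square)
  \<comment> \<open>The bound \<open>2 * (2 * m\<^sup>2 + 8)\<close> is compared with
    \<open>2 * (2 * m\<^sup>2 + 4 * m)\<close>: \<open>m \<ge> 2\<close> gives the weak and
    \<open>m \<ge> 3\<close> the strict inequality.\<close>
  have m: "m \<ge> 2" unfolding m_def using cardB n by simp
  show ?thesis
  proof (rule that[OF sum0 a])
    show "x a \<noteq> 0" using xa m by simp
    show "energy V R x \<le> 2 * (\<Sum>v\<in>V. (x v)\<^sup>2)" unfolding norm using e m by simp
    assume "card V \<ge> 7"
    then have "m \<ge> 3" unfolding m_def using cardB by simp
    then show "energy V R x < 2 * (\<Sum>v\<in>V. (x v)\<^sup>2)" unfolding norm using e by simp
  qed
qed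

end

section \<open>Frameworks with eigenvalue at least one\<close>

lemma K222_edge_iff:
  "u \<in> K222_verts \<Longrightarrow> w \<in> K222_verts \<Longrightarrow> {u, w} \<in> K222_edges \<longleftrightarrow> fst u \<noteq> fst w"
  unfolding K222_edges_def by (auto simp: doubleton_eq_iff simp del: split_paired_Ex)

lemma K222_verts_eq: "K222_verts = {(0, 0), (0, 1), (1, 0), (1, 1), (2, 0), (2, 1)}"
  unfolding K222_verts_def by (auto simp: numeral_3_eq_3 numeral_2_eq_2 less_Suc_eq)

lemma sum_K222_verts:
  fixes g :: "nat \<times> nat \<Rightarrow> real"
  shows "(\<Sum>u\<in>K222_verts. g u) = g (0, 0) + g (0, 1) + g (1, 0) + g (1, 1) + g (2, 0) + g (2, 1)"
  unfolding K222_verts_eq by (simp add: add.assoc)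

text \<open>Non-adjacency is a perfect matching with fixed-point-free involution \<open>m\<close>;
  its three pairs are the parts.\<close>

lemma graph_iso_K222I:
  assumes V: "card V = 6"
    and one: "\<And>v. v \<in> V \<Longrightarrow> \<exists>!w. w \<in> V \<and> w \<noteq> v \<and> {v, w} \<notin> E"
    and irrefl: "\<And>v. {v, v} \<notin> E"
  shows "graph_iso V E K222_verts K222_edges"
proof -
  have fin: "finite V" using V card.infinite by fastforce
  define m where "m v = (THE w. w \<in> V \<and> w \<noteq> v \<and> {v, w} \<notin> E)" for v
  have m: "m v \<in> V" "m v \<noteq> v" "{v, m v} \<notin> E" if "v \<in> V" for v
    using theI'[OF one[OF that]] unfolding m_def by auto
  have m_eq: "m v = w" if "v \<in> V" "w \<in> V" "w \<noteq> v" "{v, w} \<notin> E" for v w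
    using one[of v] m[of v] that by blast
  have mm: "m (m v) = v" if "v \<in> V" for v
    using m[OF that] that by (intro m_eq) (auto simp: insert_commute)
  have edge: "{v, w} \<in> E \<longleftrightarrow> v \<noteq> w \<and> w \<noteq> m v" if "v \<in> V" "w \<in> V" for v w
    using m[of v] m_eq[of v w] irrefl that by metis
  obtain a where a: "a \<in> V" using V by fastforce
  \<comment> \<open>Removing matched pairs leaves four and then two vertices, so representatives
    \<open>b\<close> and \<open>c\<close> of the other pairs exist.\<close>
  have "card (V - {a, m a}) = 4" using a m[OF a] V fin by (subst card_Diff_subset) auto
  then obtain b where b: "b \<in> V" "b \<noteq> a" "b \<noteq> m a" by (metis Diff_iff card.empty ex_in_conv insertI1 insertI2 zero_neq_numeral)
  have mb: "m b \<noteq> a" "m b \<noteq> m a" "m b \<noteq> b" using mm[OF a] mm[OF b(1)] m[OF b(1)] b by metis+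
  have "card (V - {a, m a, b, m b}) = 2"
    using a m[OF a] m[OF b(1)] b mb V fin by (subst card_Diff_subset) auto
  then obtain c where c: "c \<in> V" "c \<notin> {a, m a, b, m b}"
    by (metis Diff_iff card.empty ex_in_conv zero_neq_numeral)
  have mc: "m c \<noteq> a" "m c \<noteq> m a" "m c \<noteq> b" "m c \<noteq> m b" "m c \<noteq> c"
    using mm[OF a] mm[OF b(1)] mm[OF c(1)] m[OF c(1)] c by (metis insertI1 insertI2)+
  let ?W = "{a, m a, b, m b, c, m c}"
  have dist: "distinct [a, m a, b, m b, c, m c]"
    using m[OF a] b mb c mc by auto
  have "card ?W = 6" using distinct_card[OF dist] by simp
  then have VW: "?W = V" using a b c m V fin by (intro card_seteq) auto
  define f where "f v = (if v = a then (0, 0) else if v = m a then (0, 1) else if v = b then (1, 0)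
    else if v = m b then (1, 1) else if v = c then (2, 0) else (2::nat, 1::nat))" for v
  have f: "f a = (0, 0)" "f (m a) = (0, 1)" "f b = (1, 0)" "f (m b) = (1, 1)" "f c = (2, 0)" "f (m c) = (2, 1)"
    using dist unfolding f_def by auto
  have img: "f ` V = K222_verts" unfolding VW[symmetric] K222_verts_eq by (simp add: f)
  have "inj_on f V" unfolding VW[symmetric] by (auto simp: inj_on_def f)
  then have "bij_betw f V K222_verts" using img unfolding bij_betw_def by simp
  moreover have "{v, w} \<in> E \<longleftrightarrow> {f v, f w} \<in> K222_edges" if "v \<in> V" "w \<in> V" for v w
  proof -
    have "v \<in> ?W" "w \<in> ?W" using that VW by auto
    then have "(v \<noteq> w \<and> w \<noteq> m v) \<longleftrightarrow> fst (f v) \<noteq> fst (f w)"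
      using dist mm[OF a] mm[OF b(1)] mm[OF c(1)] by (elim insertE emptyE) (simp_all add: f, auto)
    moreover have "f v \<in> K222_verts" "f w \<in> K222_verts" using img that by auto
    ultimately show ?thesis using edge[OF that] K222_edge_iff by blast
  qed
  ultimately show ?thesis unfolding graph_iso_def by blast
qed

section \<open>Monochromatic subgraphs of a framework\<close>

context framework
begin

abbreviation "nbi i \<equiv> neighbours V (adj i)"

sublocale rel: symmetric_relation V "adj i" for i
  using finite_V adj_commute adjD by unfold_locales blast+

text \<open>The handshake lemma, summed over colours; every edge has exactly one colour.\<close>

lemma sum_degrees: "(\<Sum>i<d. \<Sum>v\<in>V. card (nbi i v)) = 2 * card E"
proof -
  have "2 * real (card E) = (\<Sum>v\<in>V. \<Sum>w\<in>V. if {v, w} \<in> E then 1 else 0)"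
    using sum_over_edges[OF graph, of "\<lambda>_. 1"] by simp
  also have "\<dots> = (\<Sum>v\<in>V. \<Sum>w\<in>V. \<Sum>i<d. if adj i v w then 1 else 0)"
  proof (intro sum.cong refl)
    fix v w
    have "(\<Sum>i<d. if adj i v w then 1 else 0 :: real)
      = (\<Sum>i<d. if i = dominant_axis d p v w then if {v, w} \<in> E then 1 else 0 else 0)"
      unfolding axis_adj_def by (intro sum.cong) auto
    also have "\<dots> = (if {v, w} \<in> E then 1 else 0)" using dominant_axis(1) by auto
    finally show "(if {v, w} \<in> E then 1 else 0 :: real) = (\<Sum>i<d. if adj i v w then 1 else 0)" by simp
  qed
  also have "\<dots> = (\<Sum>v\<in>V. \<Sum>i<d. \<Sum>w\<in>V. if adj i v w then 1 else 0)"
    by (intro sum.cong refl sum.swap)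
  also have "\<dots> = (\<Sum>i<d. \<Sum>v\<in>V. \<Sum>w\<in>V. if adj i v w then 1 else 0)" by (rule sum.swap)
  also have "\<dots> = real (\<Sum>i<d. \<Sum>v\<in>V. card (nbi i v))"
    unfolding neighbours_def using finite_V by (simp add: sum.inter_filter[symmetric])
  finally show ?thesis by linarith
qed

lemma all_neighbours: "{w \<in> V. {v, w} \<in> E} = (\<Union>i<d. nbi i v)"
  unfolding neighbours_def axis_adj_def using dominant_axis(1) by blast

lemma card_all_neighbours: "card {w \<in> V. {v, w} \<in> E} = (\<Sum>i<d. card (nbi i v))"
  unfolding all_neighbours using rel.finite_nb
  by (intro card_UN_disjoint) (auto simp: neighbours_def axis_adj_def)

text \<open>On the complete graph, being joined along axis \<open>0\<close> in increasing direction is a transitive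
  relation. In a 2-regular graph on five vertices it therefore makes every vertex a source or a
  sink, which contradicts the odd number of edges.\<close>

lemma no_two_regular_planar_K5:
  assumes d2: "d = 2" and n: "card V = 5"
    and complete: "\<And>v w. v \<in> V \<Longrightarrow> w \<in> V \<Longrightarrow> v \<noteq> w \<Longrightarrow> {v, w} \<in> E"
    and reg: "\<And>v. v \<in> V \<Longrightarrow> card (nbi 0 v) = 2"
  shows False
proof -
  define up where "up v w \<longleftrightarrow> adj 0 v w \<and> p v $ 0 < p w $ 0" for v w
  have diff: "(p v - p w) $ i = p v $ i - p w $ i" if "v \<in> V" "w \<in> V" "i < 2" for v w i
    using p_carrier[OF that(1)] p_carrier[OF that(2)] that(3) d2 by auto
  have adj0: "\<bar>p v $ 1 - p w $ 1\<bar> < \<bar>p v $ 0 - p w $ 0\<bar>" if "adj 0 v w" for v w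
    using that dominant_axis(2)[of v w 1] diff[of v w] adjD[OF that] d2
    unfolding axis_adj_def by auto
  have adj_total: "adj 0 v w \<longleftrightarrow> up v w \<or> up w v" for v w
  proof -
    have "p v $ 0 \<noteq> p w $ 0" if "adj 0 v w" using adj0[OF that] by auto
    then show ?thesis unfolding up_def using adj_commute[of 0 v w] by (auto simp: neq_iff)
  qed
  \<comment> \<open>Increments of the first coordinate add up, while the triangle inequality bounds
    the difference of the second ones. Completeness makes \<open>{a, b}\<close> an edge.\<close>
  have trans: "up a b" if "up a v" "up v b" for a v b
  proof -
    have V: "a \<in> V" "b \<in> V" using that adjD unfolding up_def by blast+
    have lt: "p a $ 0 < p b $ 0" "\<bar>p a $ 1 - p b $ 1\<bar> < \<bar>p a $ 0 - p b $ 0\<bar>"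
      using that adj0[of a v] adj0[of v b] unfolding up_def by linarith+
    have "dominant_axis d p a b = 0"
    proof (rule dominant_axis_eqI)
      show "p b \<in> carrier_vec d" using p_carrier V by blast
      show "0 < d" using d2 by simp
      fix j assume "j < d" "j \<noteq> 0"
      then have "j = 1" using d2 by simp
      then show "\<bar>(p a - p b) $ j\<bar> < \<bar>(p a - p b) $ 0\<bar>" using lt(2) diff[OF V] by simp
    qed
    moreover have "a \<noteq> b" using lt by auto
    ultimately show ?thesis unfolding up_def axis_adj_def using complete[OF V] lt by auto
  qed
  have no_path: "\<not> (up a v \<and> up v b)" for a v b
  proof
    assume "up a v \<and> up v b"
    moreover from this have "up a b" using trans by blast
    ultimately have adjs: "adj 0 a v" "adj 0 v b" "adj 0 a b" unfolding up_def by auto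
    \<comment> \<open>By 2-regularity this triangle is a whole component. Two vertices remain, each
      with at most one neighbour.\<close>
    let ?T = "{a, v, b}"
    have T: "card ?T = 3" "?T \<subseteq> V" using adjs adjD by (auto simp: card_insert_if)
    have nbT: "nbi 0 t \<subseteq> ?T" if "t \<in> ?T" for t
    proof -
      have "?T - {t} \<subseteq> nbi 0 t" using that adjs adj_commute T(2) unfolding neighbours_def by auto
      moreover have "card (?T - {t}) = 2" using that T by (simp add: card_Diff_singleton)
      ultimately have "?T - {t} = nbi 0 t"
        using reg[of t] T that rel.finite_nb[of 0 t] by (intro card_subset_eq) auto
      then show ?thesis by auto
    qed
    have "card (V - ?T) = 2" using T n by (subst card_Diff_subset) auto
    then obtain c where c: "c \<in> V - ?T" by (metis card.empty ex_in_conv zero_neq_numeral)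
    have "nbi 0 c \<subseteq> V - ?T - {c}"
    proof
      fix w assume w: "w \<in> nbi 0 c"
      then have "w \<in> V" "adj 0 c w" "c \<in> nbi 0 w" using adj_commute c unfolding neighbours_def by auto
      then show "w \<in> V - ?T - {c}" using nbT[of w] c adjD by auto
    qed
    then have "card (nbi 0 c) \<le> card (V - ?T - {c})" using finite_V by (intro card_mono) auto
    also have "\<dots> = 1" using \<open>card (V - ?T) = 2\<close> c by (subst card_Diff_singleton) auto
    finally show False using reg[of c] c by simp
  qed
  define out where "out v = {w \<in> V. up v w}" for v
  have fin_out: "finite (out v)" for v unfolding out_def using finite_V by simp
  \<comment> \<open>A vertex with an outgoing edge has no incoming one, so its out-degree is 0 or 2.
    The out-degrees sum to 5, half of the degree sum 10.\<close>
  have even_out: "even (card (out v))" if "v \<in> V" for v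
  proof (cases "out v = {}")
    case False
    then obtain b where "up v b" unfolding out_def by auto
    then have "out v = nbi 0 v"
      using no_path adj_total unfolding out_def neighbours_def by blast
    then show ?thesis using reg[OF that] by simp
  qed simp
  have deg: "card (nbi 0 v) = card (out v) + card {w \<in> V. up w v}" for v
  proof -
    have "nbi 0 v = out v \<union> {w \<in> V. up w v}"
      unfolding neighbours_def out_def using adj_total by blast
    moreover have "out v \<inter> {w \<in> V. up w v} = {}" unfolding out_def up_def by auto
    ultimately show ?thesis using fin_out finite_V by (simp add: card_Un_disjoint)
  qed
  have "(\<Sum>v\<in>V. card {w \<in> V. up w v}) = (\<Sum>v\<in>V. card (out v))"
  proof -
    have "(\<Sum>v\<in>V. card {w \<in> V. up w v}) = (\<Sum>v\<in>V. \<Sum>w\<in>V. if up w v then 1 else 0)"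
      using finite_V by (simp add: sum.inter_filter[symmetric])
    also have "\<dots> = (\<Sum>w\<in>V. \<Sum>v\<in>V. if up w v then 1 else 0)" by (rule sum.swap)
    also have "\<dots> = (\<Sum>v\<in>V. card (out v))"
      unfolding out_def using finite_V by (simp add: sum.inter_filter[symmetric])
    finally show ?thesis .
  qed
  moreover have "(\<Sum>v\<in>V. card (nbi 0 v)) = 10" using reg n by simp
  ultimately have "(\<Sum>v\<in>V. card (out v)) = 5" unfolding deg sum.distrib by simp
  moreover have "even (\<Sum>v\<in>V. card (out v))" using even_out by (intro dvd_sum) auto
  ultimately show False by simp
qed

text \<open>With the bound by 1 in the conclusion, this covers the upper bound as well as the
  equality case: an eigenvalue above 1 contradicts it.\<close>

lemma eigenvalue_ge_1_imp_octahedron: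
  assumes n: "card V \<ge> d + 1" and m: "card E \<le> d * card V"
    and one: "nth_eigenvalue (d + 1) L \<ge> 1"
  shows "d = 2 \<and> graph_iso V E K222_verts K222_edges \<and> nth_eigenvalue (d + 1) L \<le> 1"
proof -
  note gap = spectral_gap[OF n one]
  have n3: "card V \<ge> 3" using n d by simp
  have ge2: "card (nbi i v) \<ge> 2" if i: "i < d" and v: "v \<in> V" for i v
  proof (rule ccontr)
    assume "\<not> ?thesis"
    moreover have "nbi i v \<noteq> {}" using rel.gap_no_isolated[OF gap[OF i]] n3 v by auto
    then have "card (nbi i v) \<noteq> 0" using rel.finite_nb by simp
    ultimately have "card (nbi i v) = 1" by simp
    then obtain c where c: "nbi i v = {c}" by (auto simp: card_1_singleton_iff)
    then have cV: "c \<in> V" unfolding neighbours_def by auto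
    have dom: "nbi i c = V - {c}" by (rule rel.gap_leaf_neighbour[OF gap[OF i] v c])
    \<comment> \<open>All edges at \<open>c\<close> have colour \<open>i\<close>, since
      \<open>c\<close> is joined to every other vertex in that colour; but \<open>c\<close> cannot
      be isolated in another colour \<open>j\<close>.\<close>
    define j where "j = (if i = 0 then 1 else 0 :: nat)"
    have j: "j < d" "j \<noteq> i" unfolding j_def using d by auto
    have "nbi j c \<noteq> {}" using rel.gap_no_isolated[OF gap[OF j(1)]] n3 cV by auto
    then obtain w where w: "w \<in> V" "adj j c w" unfolding neighbours_def by auto
    then have "w \<in> nbi i c" unfolding dom using adjD by auto
    then show False using w j unfolding neighbours_def axis_adj_def by auto
  qed
  \<comment> \<open>A degree above 2 would push the degree sum beyond \<open>2 * d * card V\<close>,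
    against \<open>sum_degrees\<close> and the edge bound.\<close>
  have reg: "card (nbi i v) = 2" if i: "i < d" and v: "v \<in> V" for i v
  proof (rule ccontr)
    assume ne: "\<not> ?thesis"
    have "(\<Sum>i<d. \<Sum>v\<in>V. 2) < (\<Sum>i<d. \<Sum>v\<in>V. card (nbi i v))"
    proof (rule sum_strict_mono_ex1)
      show "\<forall>i\<in>{..<d}. (\<Sum>v\<in>V. 2) \<le> (\<Sum>v\<in>V. card (nbi i v))" using ge2 by (auto intro!: sum_mono simp del: sum_constant)
      have "(\<Sum>v\<in>V. 2) < (\<Sum>v\<in>V. card (nbi i v))"
        using ge2[OF i] ne v finite_V by (intro sum_strict_mono_ex1) force+
      then show "\<exists>i\<in>{..<d}. (\<Sum>v\<in>V. 2) < (\<Sum>v\<in>V. card (nbi i v))" using i by blast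
    qed simp
    then show False unfolding sum_degrees using m by simp
  qed
  have deg: "card {w \<in> V. {v, w} \<in> E} = 2 * d" if "v \<in> V" for v
    unfolding card_all_neighbours using reg[OF _ that] by simp
  have sub: "{w \<in> V. {v, w} \<in> E} \<subseteq> V - {v}" for v using edgeD by auto
  have cardV: "card (V - {v}) = card V - 1" if "v \<in> V" for v using that by simp
  \<comment> \<open>A vertex has \<open>2 * d\<close> distinct neighbours, two in each
    colour.\<close>
  have low: "2 * d + 1 \<le> card V"
  proof -
    obtain v where v: "v \<in> V" using n3 by fastforce
    have "2 * d \<le> card V - 1"
      using card_mono[OF _ sub[of v]] finite_V deg[OF v] cardV[OF v] by simp
    then show ?thesis using n3 by simp
  qed
  have i0: "0 < d" using d by simp
  \<comment> \<open>The test vector for colour 0 bounds the eigenvalue by 1; with seven or more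
    vertices its strict inequality contradicts the gap.\<close>
  have test: "nth_eigenvalue (d + 1) L \<le> 1 \<and> card V = 6" if n6: "card V \<ge> 6"
  proof -
    obtain x u where x: "(\<Sum>v\<in>V. x v) = 0" "u \<in> V" "x u \<noteq> 0"
      "energy V (adj 0) x \<le> 2 * (\<Sum>v\<in>V. (x v)\<^sup>2)"
      "card V \<ge> 7 \<Longrightarrow> energy V (adj 0) x < 2 * (\<Sum>v\<in>V. (x v)\<^sup>2)"
      using rel.two_regular_test_vector[OF reg[OF i0] n6] by blast
    have "nth_eigenvalue (d + 1) L \<le> 1"
      using nth_eigenvalue_stiffness_le[OF n i0 x(1-3), of 1] x(4) by simp
    moreover have "\<not> card V \<ge> 7" using x(5) gap[OF i0 x(1)] by linarith
    ultimately show ?thesis using n6 by simp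
  qed
  have le6: "card V \<le> 6" using test by linarith
  then have d2: "d = 2" using low d by linarith
  have "card V \<noteq> 5"
  proof
    assume 5: "card V = 5"
    have "{v, w} \<in> E" if "v \<in> V" "w \<in> V" "v \<noteq> w" for v w
    proof -
      have "{w \<in> V. {v, w} \<in> E} = V - {v}"
        using sub[of v] deg[OF that(1)] cardV[OF that(1)] 5 d2 finite_V by (intro card_subset_eq) auto
      then show ?thesis using that by blast
    qed
    then show False using no_two_regular_planar_K5[OF d2 5 _ reg[OF i0]] by blast
  qed
  then have 6: "card V = 6" using low le6 d2 by simp
  have "\<exists>!w. w \<in> V \<and> w \<noteq> v \<and> {v, w} \<notin> E" if v: "v \<in> V" for v
  proof -
    have "card ((V - {v}) - {w \<in> V. {v, w} \<in> E}) = 1"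
      using sub[of v] deg[OF v] cardV[OF v] finite_V 6 d2 by (subst card_Diff_subset) auto
    then obtain w where "(V - {v}) - {w \<in> V. {v, w} \<in> E} = {w}" by (auto simp: card_1_singleton_iff)
    then have "w \<in> V \<and> w \<noteq> v \<and> {v, w} \<notin> E"
      and "\<And>u. u \<in> V \<and> u \<noteq> v \<and> {v, u} \<notin> E \<Longrightarrow> u = w" by blast+
    then show ?thesis by (rule ex1I)
  qed
  then have "graph_iso V E K222_verts K222_edges"
    using edgeD by (intro graph_iso_K222I[OF 6]) blast+
  then show ?thesis using d2 test 6 by simp
qed

end

section \<open>The octahedron and the supremum\<close>

lemma finite_mats_entries:
  assumes "finite S"
  shows "finite {A \<in> carrier_mat m n. \<forall>i<m. \<forall>j<n. A $$ (i, j) \<in> S}"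
proof (rule finite_subset)
  let ?I = "{..<m} \<times> {..<n}"
  show "{A \<in> carrier_mat m n. \<forall>i<m. \<forall>j<n. A $$ (i, j) \<in> S} \<subseteq> mat m n ` (?I \<rightarrow>\<^sub>E S)"
  proof
    fix A assume A: "A \<in> {A \<in> carrier_mat m n. \<forall>i<m. \<forall>j<n. A $$ (i, j) \<in> S}"
    then have "A = mat m n (restrict (\<lambda>ij. A $$ ij) ?I)" by (intro eq_matI) auto
    moreover have "restrict (\<lambda>ij. A $$ ij) ?I \<in> ?I \<rightarrow>\<^sub>E S" using A by auto
    ultimately show "A \<in> mat m n ` (?I \<rightarrow>\<^sub>E S)" by blast
  qed
  show "finite (mat m n ` (?I \<rightarrow>\<^sub>E S))" using assms by (intro finite_imageI finite_PiE) auto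
qed

text \<open>True for every \<open>p\<close>, even where the definite description is undetermined:
  the entry is a sign times 0 or 1.\<close>

lemma support_functional_entry:
  "k < d \<Longrightarrow> support_functional d p v w $ k \<in> {- 1, 0, 1}"
  unfolding support_functional_def by (auto simp: Let_def unit_vec_def sgn_if)

text \<open>All entries lie in a three-element set and the size is fixed. This turns the supremum
  into a maximum.\<close>

lemma finite_rigidity_matrices:
  assumes "d > 0"
  shows "finite (range (rigidity_matrix d V E))"
proof (rule finite_subset)
  have "rigidity_matrix d V E p $$ (i, j) \<in> {- 1, 0, 1}" if "i < card E" "j < d * card V" for p i j
    using that assms support_functional_entry[of "j mod d" d p "enum_list V ! (j div d)"
        "THE x. enum_list E ! i = {enum_list V ! (j div d), x}"]
    unfolding rigidity_matrix_def
    by (simp add: Let_def)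
  moreover have "rigidity_matrix d V E p \<in> carrier_mat (card E) (d * card V)" for p
    unfolding rigidity_matrix_def by simp
  ultimately show "range (rigidity_matrix d V E)
    \<subseteq> {A \<in> carrier_mat (card E) (d * card V). \<forall>i<card E. \<forall>j<d * card V. A $$ (i, j) \<in> {- 1, 0, 1}}"
    by blast
qed (rule finite_mats_entries, simp)

lemma placementsI:
  assumes d: "d \<ge> 2" and E: "\<And>v w. {v, w} \<in> E \<Longrightarrow> v \<in> V \<and> w \<in> V"
    and carrier: "\<And>v. v \<in> V \<Longrightarrow> p v \<in> carrier_vec d"
    and dom: "\<And>v w. {v, w} \<in> E \<Longrightarrow>
      \<exists>i<d. \<forall>j<d. j \<noteq> i \<longrightarrow> \<bar>p v $ j - p w $ j\<bar> < \<bar>p v $ i - p w $ i\<bar>"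
  shows "p \<in> placements d V E"
  unfolding placements_def mem_Collect_eq
proof (intro conjI ballI allI impI)
  fix v w assume e: "{v, w} \<in> E"
  obtain i where i: "i < d" and lt: "\<And>j. j < d \<Longrightarrow> j \<noteq> i \<Longrightarrow> \<bar>p v $ j - p w $ j\<bar> < \<bar>p v $ i - p w $ i\<bar>"
    using dom[OF e] by blast
  define j where "j = (if i = 0 then 1 else 0 :: nat)"
  have "j < d" "j \<noteq> i" using d unfolding j_def by auto
  then show "p v \<noteq> p w" using lt[of j] by auto
  have pv: "p v \<in> carrier_vec d" and pw: "p w \<in> carrier_vec d" using carrier E[OF e] by auto
  then have "(k < d \<and> \<bar>(p v - p w) $ k\<bar> = linf_norm (p v - p w)) \<longleftrightarrow> k = i" for k
    using lt i by (intro unique_dominant_axis) auto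
  then show "\<exists>!i. i < d \<and> \<bar>(p v - p w) $ i\<bar> = linf_norm (p v - p w)" by simp
qed (rule carrier)

text \<open>Put the vertices at distinct points of the first axis. Nonemptiness is needed for the
  supremum to be a maximum.\<close>

lemma placements_nonempty:
  assumes d: "d \<ge> 2" and G: "simple_graph V E"
  shows "placements d V E \<noteq> {}"
proof -
  have "finite V" using G unfolding simple_graph_def by simp
  then obtain g :: "'a \<Rightarrow> nat" where g: "inj_on g V" using finite_imp_inj_to_nat_seg by blast
  have E: "v \<in> V \<and> w \<in> V \<and> v \<noteq> w" if "{v, w} \<in> E" for v w
    using that G unfolding simple_graph_def nsets_def by (cases "v = w") auto
  let ?p = "\<lambda>v. vec d (\<lambda>i. if i = 0 then real (g v) else 0)"
  have "?p \<in> placements d V E"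
  proof (rule placementsI[OF d])
    fix v w assume "{v, w} \<in> E"
    then have "g v \<noteq> g w" using E g by (metis inj_on_def)
    then have "\<forall>j<d. j \<noteq> 0 \<longrightarrow> \<bar>?p v $ j - ?p w $ j\<bar> < \<bar>?p v $ 0 - ?p w $ 0\<bar>" using d by auto
    then show "\<exists>i<d. \<forall>j<d. j \<noteq> i \<longrightarrow> \<bar>?p v $ j - ?p w $ j\<bar> < \<bar>?p v $ i - ?p w $ i\<bar>"
      using d by (intro exI[of _ 0]) auto
  qed (use E in auto)
  then show ?thesis by blast
qed

section \<open>Two hexagons in the octahedron\<close>

lemma energy_bij:
  assumes f: "bij_betw f V V'"
    and R: "\<And>v w. v \<in> V \<Longrightarrow> w \<in> V \<Longrightarrow> R v w \<longleftrightarrow> R' (f v) (f w)"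
    and x: "\<And>v. v \<in> V \<Longrightarrow> x v = y (f v)"
  shows "energy V R x = energy V' R' y"
proof -
  have "energy V R x = (\<Sum>v\<in>V. \<Sum>w\<in>V. if R' (f v) (f w) then (y (f v) - y (f w))\<^sup>2 else 0)"
    unfolding energy_def using R x by (intro sum.cong) auto
  also have "\<dots> = (\<Sum>v\<in>V. \<Sum>w'\<in>V'. if R' (f v) w' then (y (f v) - y w')\<^sup>2 else 0)"
    by (intro sum.cong refl sum.reindex_bij_betw[OF f])
  also have "\<dots> = energy V' R' y"
    unfolding energy_def by (rule sum.reindex_bij_betw[OF f])
  finally show ?thesis .
qed

text \<open>The Laplacian of the 6-cycle has eigenvalues 0, 1, 1, 3, 3, 4. Subtracting the identity
  leaves -1, 0, 0, 2, 2, 3: the antipodal sums account for the value 2, the alternating sum for 3,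
  and the total sum corrects the constant vectors to -1.\<close>

lemma hexagon_gap:
  fixes a b c d e f :: real
  assumes "a + b + c + d + e + f = 0"
  shows "a\<^sup>2 + b\<^sup>2 + c\<^sup>2 + d\<^sup>2 + e\<^sup>2 + f\<^sup>2
    \<le> (a - b)\<^sup>2 + (b - c)\<^sup>2 + (c - d)\<^sup>2 + (d - e)\<^sup>2 + (e - f)\<^sup>2 + (f - a)\<^sup>2"
proof -
  have "(a - b)\<^sup>2 + (b - c)\<^sup>2 + (c - d)\<^sup>2 + (d - e)\<^sup>2 + (e - f)\<^sup>2 + (f - a)\<^sup>2
      - (a\<^sup>2 + b\<^sup>2 + c\<^sup>2 + d\<^sup>2 + e\<^sup>2 + f\<^sup>2)
    = (a + d)\<^sup>2 + (b + e)\<^sup>2 + (c + f)\<^sup>2 + (a - b + c - d + e - f)\<^sup>2 / 2 - (a + b + c + d + e + f)\<^sup>2 / 2"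
    by (simp add: power2_eq_square field_simps)
  also have "\<dots> \<ge> 0" unfolding assms by simp
  finally show ?thesis by simp
qed

text \<open>A placement of the octahedron in the plane for which both monochromatic subgraphs are
  hexagons.\<close>

definition octahedron_point :: "nat \<times> nat \<Rightarrow> real \<times> real" where
  "octahedron_point u = (if u = (0, 0) then (3, 2) else if u = (0, 1) then (- 3, 1)
     else if u = (1, 0) then (0, 3) else if u = (1, 1) then (0, - 3)
     else if u = (2, 0) then (3, - 3) else (- 3, - 1))"

definition octahedron_coord :: "nat \<Rightarrow> nat \<times> nat \<Rightarrow> real" where
  "octahedron_coord i u = (if i = 0 then fst (octahedron_point u) else snd (octahedron_point u))"

text \<open>For \<open>i < 2\<close> the natural number \<open>1 - i\<close> is the other
  axis.\<close>

definition octahedron_adj :: "nat \<Rightarrow> nat \<times> nat \<Rightarrow> nat \<times> nat \<Rightarrow> bool" where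
  "octahedron_adj i u w \<longleftrightarrow> fst u \<noteq> fst w \<and>
     \<bar>octahedron_coord (1 - i) u - octahedron_coord (1 - i) w\<bar> < \<bar>octahedron_coord i u - octahedron_coord i w\<bar>"

lemma octahedron_gap:
  assumes i: "i < 2" and y: "(\<Sum>u\<in>K222_verts. y u) = 0"
  shows "2 * (\<Sum>u\<in>K222_verts. (y u)\<^sup>2) \<le> energy K222_verts (octahedron_adj i) y"
proof -
  have sum: "y (0, 0) + y (0, 1) + y (1, 0) + y (1, 1) + y (2, 0) + y (2, 1) = 0"
    using y unfolding sum_K222_verts .
  consider "i = 0" | "i = 1" using i by linarith
  then show ?thesis
  proof cases
    case 1
    \<comment> \<open>The terms follow the edges of the hexagon of this colour in cyclic order, as
      \<open>hexagon_gap\<close> expects; likewise for the other colour.\<close>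
    have "energy K222_verts (octahedron_adj i) y = 2 * ((y (0, 0) - y (1, 0))\<^sup>2 + (y (1, 0) - y (0, 1))\<^sup>2
      + (y (0, 1) - y (2, 0))\<^sup>2 + (y (2, 0) - y (1, 1))\<^sup>2 + (y (1, 1) - y (2, 1))\<^sup>2 + (y (2, 1) - y (0, 0))\<^sup>2)"
      unfolding 1 energy_def sum_K222_verts
      by (simp add: octahedron_adj_def octahedron_coord_def octahedron_point_def,
          simp add: power2_eq_square algebra_simps)
    then show ?thesis
      using hexagon_gap[of "y (0, 0)" "y (1, 0)" "y (0, 1)" "y (2, 0)" "y (1, 1)" "y (2, 1)"] sum
      unfolding sum_K222_verts by (simp add: algebra_simps)
  next
    case 2
    have "energy K222_verts (octahedron_adj i) y = 2 * ((y (0, 0) - y (1, 1))\<^sup>2 + (y (1, 1) - y (0, 1))\<^sup>2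
      + (y (0, 1) - y (2, 1))\<^sup>2 + (y (2, 1) - y (1, 0))\<^sup>2 + (y (1, 0) - y (2, 0))\<^sup>2 + (y (2, 0) - y (0, 0))\<^sup>2)"
      unfolding 2 energy_def sum_K222_verts
      by (simp add: octahedron_adj_def octahedron_coord_def octahedron_point_def,
          simp add: power2_eq_square algebra_simps)
    then show ?thesis
      using hexagon_gap[of "y (0, 0)" "y (1, 1)" "y (0, 1)" "y (2, 1)" "y (1, 0)" "y (2, 0)"] sum
      unfolding sum_K222_verts by (simp add: algebra_simps)
  qed
qed

text \<open>Ensures a unique dominant axis for each edge, so that the chosen points form a
  placement.\<close>

lemma octahedron_coord_distinct:
  assumes "u \<in> K222_verts" "w \<in> K222_verts" "fst u \<noteq> fst w"
  shows "\<bar>octahedron_coord 0 u - octahedron_coord 0 w\<bar> \<noteq> \<bar>octahedron_coord 1 u - octahedron_coord 1 w\<bar>"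
  using assms unfolding K222_verts_eq
  by (elim insertE emptyE) (simp_all add: octahedron_coord_def octahedron_point_def)

text \<open>Pull the explicit points back along the isomorphism; both colours become hexagons, and
  \<open>nth_eigenvalue_stiffness_ge\<close> applies with \<open>\<mu> = 1\<close>.\<close>

lemma octahedron_eigenvalue_ge_1:
  assumes G: "simple_graph V E" and iso: "graph_iso V E K222_verts K222_edges"
  shows "\<exists>p \<in> placements 2 V E. nth_eigenvalue (2 + 1) (stiffness_matrix 2 V E p) \<ge> 1"
proof -
  obtain f where f: "bij_betw f V K222_verts"
    and fE: "\<And>v w. v \<in> V \<Longrightarrow> w \<in> V \<Longrightarrow> {v, w} \<in> E \<longleftrightarrow> {f v, f w} \<in> K222_edges"
    using iso unfolding graph_iso_def by blast
  have fV: "f v \<in> K222_verts" if "v \<in> V" for v using f that by (auto simp: bij_betw_def)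
  have E: "v \<in> V \<and> w \<in> V" if "{v, w} \<in> E" for v w
    using that G unfolding simple_graph_def nsets_def by auto
  have edge: "{v, w} \<in> E \<longleftrightarrow> fst (f v) \<noteq> fst (f w)" if "v \<in> V" "w \<in> V" for v w
    using fE[OF that] K222_edge_iff[OF fV fV] that by simp
  define p where "p v = vec 2 (\<lambda>i. octahedron_coord i (f v))" for v
  have p: "p v $ i = octahedron_coord i (f v)" if "i < 2" for v i unfolding p_def using that by simp
  have dom: "\<exists>i<2. \<forall>j<2. j \<noteq> i \<longrightarrow> \<bar>p v $ j - p w $ j\<bar> < \<bar>p v $ i - p w $ i\<bar>" if "{v, w} \<in> E" for v w
  proof -
    have "\<bar>p v $ 0 - p w $ 0\<bar> \<noteq> \<bar>p v $ 1 - p w $ 1\<bar>"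
      using octahedron_coord_distinct[of "f v" "f w"] fV E[OF that] edge that by (auto simp: p)
    then consider "\<bar>p v $ 1 - p w $ 1\<bar> < \<bar>p v $ 0 - p w $ 0\<bar>" | "\<bar>p v $ 0 - p w $ 0\<bar> < \<bar>p v $ 1 - p w $ 1\<bar>"
      by linarith
    then show ?thesis
    proof cases
      case 1
      then show ?thesis by (intro exI[of _ 0]) (auto simp: less_2_cases_iff)
    next
      case 2
      then show ?thesis by (intro exI[of _ 1]) (auto simp: less_2_cases_iff)
    qed
  qed
  have pl: "p \<in> placements 2 V E"
    using E dom by (intro placementsI) (auto simp: p_def)
  interpret framework 2 V E p using G pl by unfold_locales auto
  have cardV: "card V = 6"
    using bij_betw_same_card[OF f] unfolding K222_verts_def by simp
  have adj: "adj i v w \<longleftrightarrow> octahedron_adj i (f v) (f w)" if "i < 2" "v \<in> V" "w \<in> V" for i v w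
  proof (cases "{v, w} \<in> E")
    case True
    have pd: "\<bar>(p v - p w) $ j\<bar> = \<bar>octahedron_coord j (f v) - octahedron_coord j (f w)\<bar>" if "j < 2" for j
      using that unfolding p_def by simp
    have "octahedron_adj i (f v) (f w) \<longleftrightarrow> \<bar>(p v - p w) $ (1 - i)\<bar> < \<bar>(p v - p w) $ i\<bar>"
      unfolding octahedron_adj_def using True edge that pd by simp
    also have "\<dots> \<longleftrightarrow> dominant_axis 2 p v w = i"
    proof
      assume "dominant_axis 2 p v w = i"
      then show "\<bar>(p v - p w) $ (1 - i)\<bar> < \<bar>(p v - p w) $ i\<bar>"
        using dominant_axis(2)[OF True, of "1 - i"] that(1) by (auto simp: less_2_cases_iff)
    next
      assume lt: "\<bar>(p v - p w) $ (1 - i)\<bar> < \<bar>(p v - p w) $ i\<bar>"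
      show "dominant_axis 2 p v w = i"
      proof (rule dominant_axis_eqI)
        fix j :: nat assume "j < 2" "j \<noteq> i"
        then have "j = 1 - i" using that(1) by linarith
        then show "\<bar>(p v - p w) $ j\<bar> < \<bar>(p v - p w) $ i\<bar>" using lt by simp
      qed (use that p_def in auto)
    qed
    finally show ?thesis unfolding axis_adj_def using True by simp
  next
    case False
    then show ?thesis unfolding axis_adj_def octahedron_adj_def using edge that by simp
  qed
  have "1 \<le> nth_eigenvalue (2 + 1) L"
  proof (rule nth_eigenvalue_stiffness_ge)
    show "2 + 1 \<le> card V" using cardV by simp
    fix i :: nat and x :: "'a \<Rightarrow> real" assume i: "i < 2" and x0: "(\<Sum>v\<in>V. x v) = 0"
    define y where "y u = x (inv_into V f u)" for u
    have xy: "x v = y (f v)" if "v \<in> V" for v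
      unfolding y_def using f that by (simp add: bij_betw_inv_into_left)
    have sums: "(\<Sum>v\<in>V. g (x v)) = (\<Sum>u\<in>K222_verts. g (y u))" for g :: "real \<Rightarrow> real"
      using sum.reindex_bij_betw[OF f, of "\<lambda>u. g (y u)"] xy by simp
    show "2 * 1 * (\<Sum>v\<in>V. (x v)\<^sup>2) \<le> energy V (adj i) x"
      using octahedron_gap[OF i, of y] sums[of "\<lambda>t. t"] sums[of "\<lambda>t. t\<^sup>2"] x0
        energy_bij[where R' = "octahedron_adj i" and y = y, OF f adj[OF i] xy] by simp
  qed
  then show ?thesis using pl by blast
qed

theorem theorem4p14:
  fixes V :: "'v set" and E :: "'v set set" and d :: nat
  assumes "simple_graph V E"
    and "d \<ge> 2"
    and "card V \<ge> d + 1"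
    and "card E \<le> d * card V"
  shows "alg_connectivity d V E \<le> 1 \<and>
    (alg_connectivity d V E = 1 \<longleftrightarrow> d = 2 \<and> graph_iso V E K222_verts K222_edges)"
proof -
  define S where "S = (\<lambda>p. nth_eigenvalue (d + 1) (stiffness_matrix d V E p)) ` placements d V E"
  \<comment> \<open>The eigenvalue depends on \<open>p\<close> only through the rigidity matrix, so
    it takes finitely many values.\<close>
  have "finite (rigidity_matrix d V E ` placements d V E)"
    by (rule rev_finite_subset[OF finite_rigidity_matrices[of d V E]]) (use assms(2) in auto)
  then have "finite ((\<lambda>R. nth_eigenvalue (d + 1) (transpose_mat R * R)) ` rigidity_matrix d V E ` placements d V E)"
    by (rule finite_imageI)
  then have fin: "finite S" unfolding S_def stiffness_matrix_def image_image .
  have ne: "S \<noteq> {}" unfolding S_def using placements_nonempty[OF assms(2,1)] by simp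
  have alg: "alg_connectivity d V E = Max S"
    unfolding alg_connectivity_def S_def[symmetric] using cSup_eq_Max[OF fin ne] by simp
  \<comment> \<open>A placement attaining the maximum, to which the structural lemma is
    applied.\<close>
  obtain p where p: "p \<in> placements d V E"
    "alg_connectivity d V E = nth_eigenvalue (d + 1) (stiffness_matrix d V E p)"
    using Max_in[OF fin ne] unfolding alg S_def by auto
  interpret framework d V E p using assms(1,2) p(1) by unfold_locales
  note ge1 = eigenvalue_ge_1_imp_octahedron[OF assms(3,4), folded p(2)]
  have le: "alg_connectivity d V E \<le> 1" using ge1 by linarith
  moreover have "alg_connectivity d V E \<ge> 1" if oct: "d = 2" "graph_iso V E K222_verts K222_edges"
  proof -
    obtain q where q: "q \<in> placements d V E" "1 \<le> nth_eigenvalue (d + 1) (stiffness_matrix d V E q)"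
      using octahedron_eigenvalue_ge_1[OF assms(1) oct(2)] oct(1) by auto
    have "nth_eigenvalue (d + 1) (stiffness_matrix d V E q) \<in> S" unfolding S_def using q(1) by blast
    then show ?thesis unfolding alg using Max_ge[OF fin] q(2) by fastforce
  qed
  ultimately show ?thesis using ge1 by force
qed

end
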